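(* Let $\beta$ be a Pisot or Salem number. Then the continuum set $$\{\xi(y;\beta^{-1})\mid y\in\mathbb{R},\ y\geq 1\}$$ is algebraically independent.
   Context: Algebraic independence is over $\mathbb{Q}$. A Pisot number is an algebraic integer greater than $1$ whose conjugates other than itself all have absolute value less than $1$ (in particular every rational integer greater than $1$ is a Pisot number). A Salem number is an algebraic integer greater than $1$ whose conjugates other than itself all have absolute value at most $1$, with at least one conjugate of absolute value exactly $1$. For real $y>0$ and $R\ge 1$ put $\varphi(y;R):=\exp\left((\log R)^{1+y}\right)=R^{(\log R)^y}$, and set $\xi(y;X):=1+\sum_{m=1}^{\infty}X^{\lfloor \varphi(y;m)\rfloor}$, where $\lfloor x\rfloor$ is the integral part of $x$. *)

theory Defs
  imports
    "HOL-Analysis.Analysis"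
    "HOL-Computational_Algebra.Computational_Algebra"
    "HOL-Library.Poly_Mapping"
    "HOL-Library.Equipollence"
begin

(* A polynomial over the rationals in variables X_0, X_1, ... is a finitely supported map
   from monomials to coefficients; a monomial is a finitely supported exponent vector.
   The ring structure is the convolution product of Poly_Mapping. *)
type_synonym rat_mpoly = "(nat \<Rightarrow>\<^sub>0 nat) \<Rightarrow>\<^sub>0 rat"

definition mpoly_vars :: "rat_mpoly \<Rightarrow> nat set" where
  "mpoly_vars P = (\<Union>m \<in> Poly_Mapping.keys P. Poly_Mapping.keys m)"

definition mpoly_eval :: "(nat \<Rightarrow> 'a::field_char_0) \<Rightarrow> rat_mpoly \<Rightarrow> 'a" where
  "mpoly_eval x P =
     (\<Sum>m \<in> Poly_Mapping.keys P.
        of_rat (Poly_Mapping.lookup P m) *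
        (\<Prod>i \<in> Poly_Mapping.keys m. x i ^ Poly_Mapping.lookup m i))"

definition alg_indep_over_rat :: "'a::field_char_0 set \<Rightarrow> bool" where
  "alg_indep_over_rat S \<longleftrightarrow>
     (\<forall>(n::nat) x P.
        inj_on x {..<n} \<and> x ` {..<n} \<subseteq> S \<and> mpoly_vars P \<subseteq> {..<n} \<and> P \<noteq> 0
        \<longrightarrow> mpoly_eval x P \<noteq> 0)"

(* The roots of the minimal polynomial of x over the rationals: an irreducible rational
   polynomial vanishing at x is a nonzero constant multiple of it. Includes x itself. *)
definition alg_conjugates :: "complex \<Rightarrow> complex set" where
  "alg_conjugates x =
     {z. \<exists>p :: rat poly. irreducible p \<and>
           poly (map_poly of_rat p) x = 0 \<and> poly (map_poly of_rat p) z = 0}"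

definition Pisot_number :: "real \<Rightarrow> bool" where
  "Pisot_number \<beta> \<longleftrightarrow>
     algebraic_int \<beta> \<and> \<beta> > 1 \<and>
     (\<forall>z \<in> alg_conjugates (complex_of_real \<beta>) - {complex_of_real \<beta>}. cmod z < 1)"

definition Salem_number :: "real \<Rightarrow> bool" where
  "Salem_number \<beta> \<longleftrightarrow>
     algebraic_int \<beta> \<and> \<beta> > 1 \<and>
     (\<forall>z \<in> alg_conjugates (complex_of_real \<beta>) - {complex_of_real \<beta>}. cmod z \<le> 1) \<and>
     (\<exists>z \<in> alg_conjugates (complex_of_real \<beta>) - {complex_of_real \<beta>}. cmod z = 1)"

(* At R = 1 the base of powr is ln 1 = 0, and 0 powr (1 + y) = 0 is the intended value. *)
definition phi :: "real \<Rightarrow> real \<Rightarrow> real" where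
  "phi y R = exp (ln R powr (1 + y))"

(* phi is positive, so nat loses nothing; the sum over m >= 1 is reindexed by Suc. *)
definition xi :: "real \<Rightarrow> real \<Rightarrow> real" where
  "xi y X = 1 + suminf (\<lambda>m. X ^ nat \<lfloor>phi y (real (Suc m))\<rfloor>)"

end

theory Submission
  imports
    Defs
    "HOL-Real_Asymp.Real_Asymp"
    "Berlekamp_Zassenhaus.Factor_Bound"
    "Jordan_Normal_Form.Determinant"
begin

text \<open>
  If a polynomial relation between finitely many values \<open>\<xi>(y\<^sub>i; \<beta>\<^sup>-\<^sup>1)\<close> holds, expanding it gives an integer
  power series \<open>\<Sum> c\<^sub>n X\<^sup>n\<close> vanishing at \<open>\<beta>\<^sup>-\<^sup>1\<close> whose coefficients satisfy \<open>\<Sum>\<^sub>n\<^sub>\<le>\<^sub>N \<bar>c\<^sub>n\<bar> = N\<^bsup>o(1)\<^esup>\<close>.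
  The scaled tail \<open>Y\<^sub>R = \<Sum>\<^sub>j\<^sub>\<ge>\<^sub>1 c\<^bsub>R+j\<^esub> \<beta>\<^sup>-\<^sup>j\<close> lies in \<open>\<int>[\<beta>]\<close>, and since the other conjugates of \<open>\<beta>\<close> lie in the
  closed unit disc, taking norms gives \<open>\<bar>Y\<^sub>R\<bar> \<ge> R\<^bsup>-o(1)\<^esup>\<close> unless \<open>Y\<^sub>R = 0\<close>. If on an interval of length at
  least \<open>\<surd>N\<close> on both sides of some \<open>m\<close> all \<open>c\<^sub>n\<close> are nonnegative and \<open>c\<^sub>m > 0\<close>, then \<open>Y\<^sub>R > 0\<close> for all \<open>R\<close> to
  the left of \<open>m\<close> in it; as there are only \<open>N\<^bsup>o(1)\<^esup>\<close> nonzero coefficients, some \<open>R\<close> is followed by a long block of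
  zeros, which makes \<open>Y\<^sub>R\<close> too small, a contradiction.

  Such an \<open>m\<close> exists by comparing densities. The product of the series with parameters \<open>ys\<close> has about
  \<open>exp (\<Sum>\<^bsub>y \<in> ys\<^esub> (ln N)\<^bsup>1/(1+y)\<^esup>)\<close> exponents up to \<open>N\<close>, so one monomial of the relation is much denser than
  all the others. By the pigeonhole principle there is a long gap in the exponents of the other monomials, while a
  greedy expansion, which loses only powers of \<open>ln N\<close> because all \<open>y \<ge> 1\<close>, places an exponent of the densest monomial
  in the middle of this gap.
\<close>

section \<open>Integer polynomials at Pisot and Salem numbers\<close>

text \<open>The product is the norm of \<open>q\<close> in Z[X]/(p), that is, the determinant of
  multiplication by \<open>q\<close>. Computing it as an integer determinant makes integrality
  visible without symmetric functions.\<close>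

lemma prod_poly_roots_int:
  fixes p q :: "int poly" and rs :: "complex list"
  assumes mon: "lead_coeff p = 1" and dist: "distinct rs" and len: "length rs = degree p"
    and roots: "\<And>z. z \<in> set rs \<Longrightarrow> poly (of_int_poly p) z = 0"
  shows "(\<Prod>z\<leftarrow>rs. poly (of_int_poly q) z) \<in> \<int>"
proof -
  define d where "d = degree p"
  have p0: "p \<noteq> 0" using mon by auto
  \<comment> \<open>Pseudo-division works over the integers, and since \<open>p\<close> is monic it
    is genuine division with remainder.\<close>
  define r where "r i = snd (pseudo_divmod (Polynomial.monom 1 i * q) p)" for i
  have r: "Polynomial.monom 1 i * q = p * fst (pseudo_divmod (Polynomial.monom 1 i * q) p) + r i"
    "r i = 0 \<or> degree (r i) < d" for i
    using pseudo_divmod[OF p0, of "Polynomial.monom 1 i * q"] mon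
    unfolding r_def d_def by (auto simp: prod_eq_iff)
  txt \<open>
    Row \<open>i\<close> of \<open>M\<close> holds the coefficients of \<open>X\<^sup>i q\<close> modulo \<open>p\<close>, so that \<open>M V = V Dg\<close> for the
    Vandermonde matrix \<open>V\<close> of the roots; hence the product is the integer \<open>det M\<close>.
  \<close>
  define M :: "int mat" where "M = mat d d (\<lambda>(i,j). Polynomial.coeff (r i) j)"
  define V :: "complex mat" where "V = mat d d (\<lambda>(j,k). (rs ! k) ^ j)"
  define Dg :: "complex mat" where
    "Dg = mat d d (\<lambda>(j,k). if j = k then poly (of_int_poly q) (rs ! k) else 0)"
  have car: "M \<in> carrier_mat d d" "V \<in> carrier_mat d d" "Dg \<in> carrier_mat d d"
    "map_mat complex_of_int M \<in> carrier_mat d d"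
    by (auto simp: M_def V_def Dg_def)
  have ev: "(\<Sum>j<d. of_int (Polynomial.coeff (r i) j) * z ^ j) = z ^ i * poly (of_int_poly q) z"
    if "z \<in> set rs" for i and z :: complex
  proof (cases "d = 0")
    case True
    then show ?thesis using that len by (auto simp: d_def)
  next
    case False
    hence deg: "degree (r i) < d" using r(2)[of i] by auto
    have "poly (of_int_poly (r i)) z = (\<Sum>j\<le>degree (r i). of_int (Polynomial.coeff (r i) j) * z ^ j)"
      by (simp add: poly_altdef)
    also have "\<dots> = (\<Sum>j<d. of_int (Polynomial.coeff (r i) j) * z ^ j)"
      using deg by (intro sum.mono_neutral_left) (auto simp: coeff_eq_0)
    finally have "(\<Sum>j<d. of_int (Polynomial.coeff (r i) j) * z ^ j) = poly (of_int_poly (r i)) z" ..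
    also have "\<dots> = poly (of_int_poly (Polynomial.monom 1 i * q)) z"
      using roots[OF that] by (subst r(1)[of i]) (simp add: of_int_poly_hom.hom_add of_int_poly_hom.hom_mult)
    also have "\<dots> = z ^ i * poly (of_int_poly q) z"
      by (simp add: of_int_poly_hom.hom_mult poly_monom)
    finally show ?thesis .
  qed
  have eq: "map_mat complex_of_int M * V = V * Dg"
  proof (rule eq_matI)
    fix i k assume "i < dim_row (V * Dg)" "k < dim_col (V * Dg)"
    hence ik: "i < d" "k < d" by (auto simp: V_def Dg_def)
    have "(map_mat complex_of_int M * V) $$ (i,k) = (\<Sum>j<d. of_int (Polynomial.coeff (r i) j) * (rs ! k) ^ j)"
      using ik by (auto simp: M_def V_def scalar_prod_def atLeast0LessThan intro!: sum.cong)
    also have "\<dots> = (rs ! k) ^ i * poly (of_int_poly q) (rs ! k)"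
      using ik len by (intro ev) (auto simp: d_def)
    also have "\<dots> = (\<Sum>j<d. (rs ! j) ^ i * (if j = k then poly (of_int_poly q) (rs ! k) else 0))"
      using ik by (simp add: sum.delta if_distrib cong: if_cong)
    also have "\<dots> = (V * Dg) $$ (i,k)"
      using ik by (auto simp: V_def Dg_def scalar_prod_def atLeast0LessThan intro!: sum.cong)
    finally show "(map_mat complex_of_int M * V) $$ (i,k) = (V * Dg) $$ (i,k)" .
  qed (auto simp: M_def V_def Dg_def)
  \<comment> \<open>A kernel vector of the transpose would be the coefficient vector of a nonzero
    polynomial of degree below \<open>d\<close> with \<open>d\<close> distinct roots.\<close>
  have V0: "det V \<noteq> 0"
  proof
    assume "det V = 0"
    hence "det (transpose_mat V) = 0" using det_transpose[OF car(2)] by simp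
    then obtain v where v: "v \<in> carrier_vec d" "v \<noteq> 0\<^sub>v d" "transpose_mat V *\<^sub>v v = 0\<^sub>v d"
      using det_0_iff_vec_prod_zero_field[of "transpose_mat V" d] car(2) by auto
    define f where "f = (\<Sum>j<d. Polynomial.monom (vec_index v j) j)"
    have cf: "Polynomial.coeff f j = (if j < d then vec_index v j else 0)" for j
      by (auto simp: f_def coeff_sum if_distrib sum.delta cong: if_cong)
    have "poly f z = 0" if "z \<in> set rs" for z
    proof -
      from that obtain k where k: "k < d" "z = rs ! k" using len by (auto simp: in_set_conv_nth d_def)
      have "0 = vec_index (transpose_mat V *\<^sub>v v) k" using v k by simp
      also have "\<dots> = (\<Sum>j<d. (rs ! k) ^ j * vec_index v j)"
        using k v(1) by (auto simp: V_def scalar_prod_def atLeast0LessThan intro!: sum.cong)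
      also have "\<dots> = poly f z" by (simp add: f_def poly_sum poly_monom k mult.commute)
      finally show ?thesis by simp
    qed
    hence sub: "set rs \<subseteq> {z. poly f z = 0}" by auto
    have f0: "f \<noteq> 0"
    proof
      assume "f = 0"
      hence "vec_index v j = 0" if "j < d" for j using cf[of j] that by simp
      thus False using v by (auto simp: vec_eq_iff)
    qed
    have "d = card (set rs)" using dist len by (simp add: distinct_card d_def)
    also have "\<dots> \<le> card {z. poly f z = 0}" using sub f0 by (intro card_mono poly_roots_finite)
    also have "\<dots> \<le> degree f" using f0 by (rule card_poly_roots_bound)
    finally have "d \<le> degree f" .
    hence "Polynomial.coeff f (degree f) = 0" using cf by simp
    thus False using f0 by simp
  qed
  have "of_int (det M) * det V = det V * det Dg"
    using arg_cong[OF eq, of det] car by (simp add: det_mult of_int_hom.hom_det)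
  hence "of_int (det M) = det Dg" using V0 by (simp add: mult.commute)
  also have "det Dg = prod_list (diag_mat Dg)"
    by (rule det_upper_triangular) (auto simp: Dg_def)
  also have "diag_mat Dg = map (\<lambda>z. poly (of_int_poly q) z) rs"
    using len by (auto simp: diag_mat_def Dg_def list_eq_iff_nth_eq d_def)
  finally show ?thesis by (metis Ints_of_int)
qed

lemma map_poly_of_rat_mult:
  "map_poly (of_rat :: rat \<Rightarrow> complex) (p * q) = map_poly of_rat p * map_poly of_rat q"
proof -
  interpret map_poly_comm_ring_hom "of_rat :: rat \<Rightarrow> complex" ..
  show ?thesis by (rule hom_mult)
qed

text \<open>The two polynomials are coprime, and evaluating a Bezout identity at \<open>z\<close>
  gives 1 = 0. This serves twice: it shows that minimal polynomials are separable, and that an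
  integer polynomial nonzero at \<beta> is nonzero at every conjugate.\<close>

lemma irreducible_rat_no_common_root:
  fixes P Q :: "rat poly" and z :: complex
  assumes "irreducible P" and "\<not> P dvd Q"
    and "poly (map_poly of_rat P) z = 0" and "poly (map_poly of_rat Q) z = 0"
  shows False
proof -
  have "coprime P Q"
    using assms(1,2) by (simp add: irreducible_imp_prime_elem_gcd prime_elem_imp_coprime)
  hence "fst (bezout_coefficients P Q) * P + snd (bezout_coefficients P Q) * Q = 1"
    by (simp add: bezout_coefficients_fst_snd)
  hence "1 = (map_poly of_rat (fst (bezout_coefficients P Q) * P + snd (bezout_coefficients P Q) * Q)
    :: complex poly)" by simp
  also have "\<dots> = map_poly of_rat (fst (bezout_coefficients P Q)) * map_poly of_rat P +
      map_poly of_rat (snd (bezout_coefficients P Q)) * map_poly of_rat Q"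
    by (simp add: hom_distribs map_poly_of_rat_mult)
  finally have "poly 1 z = poly (map_poly of_rat (fst (bezout_coefficients P Q)) * map_poly of_rat P +
      map_poly of_rat (snd (bezout_coefficients P Q)) * map_poly of_rat Q) z" by simp
  thus False using assms(3,4) by simp
qed

lemma algebraic_int_irreducible_monic:
  fixes x :: real
  assumes "algebraic_int x"
  obtains p :: "int poly" where "lead_coeff p = 1" "poly (of_int_poly p) x = 0"
    "irreducible (of_int_poly p :: rat poly)"
proof -
  txt \<open>A monic integer polynomial of least degree with root \<open>x\<close> is irreducible by Gauss's lemma.\<close>
  define A where "A p \<longleftrightarrow> lead_coeff p = 1 \<and> poly (of_int_poly p) x = 0" for p :: "int poly"
  have "\<exists>p. A p" using assms unfolding algebraic_int_altdef_ipoly A_def by auto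
  then obtain p where p: "A p" and min: "\<And>q. A q \<Longrightarrow> degree p \<le> degree q"
    using ex_has_least_nat[of A _ degree] by metis
  have p0: "p \<noteq> 0" using p by (auto simp: A_def)
  have pm: "lead_coeff p = 1" "poly (of_int_poly p) x = 0" using p by (auto simp: A_def)
  have deg0: "degree p \<noteq> 0"
  proof
    assume "degree p = 0"
    then obtain a where "p = [:a:]" by (meson degree_eq_zeroE)
    thus False using pm by simp
  qed
  have "irreducible (of_int_poly p :: rat poly)"
  proof (rule irreducibleI)
    show "(of_int_poly p :: rat poly) \<noteq> 0" using p0 by simp
    show "\<not> is_unit (of_int_poly p :: rat poly)" using p0 deg0 by (simp add: is_unit_iff_degree)
    fix g h :: "rat poly" assume gh: "of_int_poly p = g * h"
    from rat_to_int_factor[OF gh] obtain g' h' where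
      g'h': "p = g' * h'" "degree g' = degree g" "degree h' = degree h" by blast
    have nz: "g' \<noteq> 0" "h' \<noteq> 0" "g \<noteq> 0" "h \<noteq> 0" using g'h'(1) gh p0 by auto
    \<comment> \<open>The factor vanishing at \<open>x\<close> has leading coefficient 1 or -1, so
      up to sign it competes with \<open>p\<close> for least degree.\<close>
    have key: "degree b = 0" if "p = a * b" "poly (of_int_poly a) x = 0" for a b
    proof -
      have ab: "a \<noteq> 0" "b \<noteq> 0" using that p0 by auto
      have "lead_coeff a * lead_coeff b = 1" using pm(1) that(1) by (simp add: lead_coeff_mult)
      hence "lead_coeff a = 1 \<or> lead_coeff a = -1" using zmult_eq_1_iff by blast
      hence "A a \<or> A (-a)" unfolding A_def using that(2) by (auto simp: hom_distribs)
      hence "degree p \<le> degree a" using min[of a] min[of "-a"] by auto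
      thus ?thesis using that(1) ab by (simp add: degree_mult_eq)
    qed
    have "poly (of_int_poly g') x = 0 \<or> poly (of_int_poly h') x = 0"
      using pm(2) g'h'(1) by (simp add: hom_distribs)
    hence "degree g' = 0 \<or> degree h' = 0"
      using key[of g' h'] key[of h' g'] g'h'(1) by (auto simp: mult.commute)
    thus "is_unit g \<or> is_unit h" using g'h' nz by (simp add: is_unit_iff_degree)
  qed
  thus ?thesis using that pm by blast
qed

text \<open>The norm of the value is a nonzero integer, hence at least 1 in modulus. Every conjugate
  factor other than the one at \<beta> is at most the sum of the absolute coefficients, because
  those conjugates lie in the closed unit disc; \<open>D\<close> counts them.\<close>

lemma Pisot_Salem_lower_bound:
  fixes \<beta> :: real
  assumes "Pisot_number \<beta> \<or> Salem_number \<beta>"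
  obtains D :: nat where "\<And>(c :: nat \<Rightarrow> int) R. (\<Sum>i\<le>R. of_int (c i) * \<beta> ^ i) \<noteq> 0 \<Longrightarrow>
     1 \<le> \<bar>\<Sum>i\<le>R. of_int (c i) * \<beta> ^ i\<bar> * (1 + (\<Sum>i\<le>R. of_int \<bar>c i\<bar>)) ^ D"
proof -
  have ai: "algebraic_int \<beta>" and conj: "\<And>z. z \<in> alg_conjugates (of_real \<beta>) - {of_real \<beta>} \<Longrightarrow> cmod z \<le> 1"
    using assms unfolding Pisot_number_def Salem_number_def by (auto intro: less_imp_le)
  obtain p where p: "lead_coeff p = 1" "poly (of_int_poly p) \<beta> = 0"
    "irreducible (of_int_poly p :: rat poly)"
    using algebraic_int_irreducible_monic[OF ai] by metis
  have of_rat_int: "map_poly of_rat (of_int_poly r :: rat poly) = (of_int_poly r :: complex poly)" for r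
    by (simp add: map_poly_map_poly o_def)
  have ev_real: "poly (of_int_poly r) (complex_of_real y) = of_real (poly (of_int_poly r) y)" for r y
    by (simp add: poly_altdef)
  have p0: "p \<noteq> 0" using p by auto
  define Pc :: "complex poly" where "Pc = of_int_poly p"
  \<comment> \<open>A multiple root would be shared with the derivative, which the irreducible
    \<open>p\<close> does not divide.\<close>
  have "rsquarefree Pc"
    unfolding rsquarefree_roots
  proof (intro allI notI)
    fix a assume a: "poly Pc a = 0 \<and> poly (pderiv Pc) a = 0"
    have deg: "degree p \<noteq> 0"
    proof
      assume "degree p = 0"
      then obtain b where "p = [:b:]" by (meson degree_eq_zeroE)
      thus False using p by simp
    qed
    have "\<not> (of_int_poly p :: rat poly) dvd pderiv (of_int_poly p)"
      using not_dvd_pderiv[of "of_int_poly p :: rat poly"] deg by simp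
    moreover have "map_poly of_rat (pderiv (of_int_poly p :: rat poly)) = pderiv Pc"
      unfolding Pc_def by (simp flip: of_int_hom.map_poly_pderiv add: of_rat_int)
    ultimately show False
      using irreducible_rat_no_common_root[OF p(3), of "pderiv (of_int_poly p)" a] a
      by (simp add: of_rat_int Pc_def)
  qed
  define S where "S = {z. poly Pc z = 0}"
  have Pc0: "Pc \<noteq> 0" using p0 by (simp add: Pc_def)
  have cardS: "card S = degree p" and finS: "finite S"
    using rsquarefree_card_degree[OF Pc0] \<open>rsquarefree Pc\<close> Pc0 poly_roots_finite[OF Pc0]
    by (auto simp: S_def Pc_def)
  obtain rs where rs: "set rs = S" "distinct rs" using finite_distinct_list[OF finS] by auto
  have \<beta>S: "complex_of_real \<beta> \<in> S" using p(2) by (simp add: S_def Pc_def ev_real)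
  have le1: "cmod z \<le> 1" if "z \<in> S - {of_real \<beta>}" for z
  proof (rule conj)
    show "z \<in> alg_conjugates (complex_of_real \<beta>) - {complex_of_real \<beta>}"
      using that p(3) \<beta>S unfolding alg_conjugates_def
      by (auto simp: S_def Pc_def of_rat_int intro!: exI[of _ "of_int_poly p"])
  qed
  show ?thesis
  proof (rule that[of "card (S - {of_real \<beta>})"])
    fix c :: "nat \<Rightarrow> int" and R :: nat
    assume nz: "(\<Sum>i\<le>R. of_int (c i) * \<beta> ^ i) \<noteq> 0"
    define q where "q = (\<Sum>i\<le>R. Polynomial.monom (c i) i)"
    have q: "poly (of_int_poly q) z = (\<Sum>i\<le>R. of_int (c i) * z ^ i)" for z :: "'a :: {comm_ring_1,ring_char_0}"
      by (simp add: q_def hom_distribs poly_sum poly_monom)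
    define B :: real where "B = 1 + (\<Sum>i\<le>R. of_int \<bar>c i\<bar>)"
    have N: "(\<Prod>z\<in>S. poly (of_int_poly q) z) \<in> (\<int> :: complex set)"
    proof -
      have "length rs = degree p" "\<And>z. z \<in> set rs \<Longrightarrow> poly (of_int_poly p) z = 0"
        using rs cardS distinct_card[OF rs(2)] by (auto simp: S_def Pc_def)
      from prod_poly_roots_int[OF p(1) rs(2) this, of q] show ?thesis
        using prod.distinct_set_conv_list[OF rs(2), of "poly (of_int_poly q)"] rs(1) by simp
    qed
    \<comment> \<open>A zero at one conjugate forces \<open>p\<close> to divide \<open>q\<close>
      over the rationals, and then \<open>q\<close> vanishes at \<beta> as well.\<close>
    have "poly (of_int_poly q) z \<noteq> 0" if z: "z \<in> S" for z :: complex
    proof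
      assume *: "poly (of_int_poly q) z = 0"
      have "\<not> (of_int_poly p :: rat poly) dvd of_int_poly q"
      proof
        assume "(of_int_poly p :: rat poly) dvd of_int_poly q"
        then obtain h where h: "of_int_poly q = (of_int_poly p :: rat poly) * h" by blast
        have "(of_int_poly q :: complex poly) = map_poly of_rat (of_int_poly q)" by (simp add: of_rat_int)
        also have "\<dots> = Pc * map_poly of_rat h" unfolding h by (simp add: map_poly_of_rat_mult of_rat_int Pc_def)
        finally have "poly (of_int_poly q) (complex_of_real \<beta>) = 0" using \<beta>S by (simp add: S_def)
        hence "poly (of_int_poly q) \<beta> = 0" unfolding ev_real by simp
        thus False using nz unfolding q by simp
      qed
      thus False using irreducible_rat_no_common_root[OF p(3), of "of_int_poly q" z] * z
        by (simp add: of_rat_int S_def Pc_def)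
    qed
    hence "(\<Prod>z\<in>S. poly (of_int_poly q) z) \<noteq> 0" using finS by simp
    with N have "1 \<le> cmod (\<Prod>z\<in>S. poly (of_int_poly q) z)"
      by (elim Ints_cases) (auto simp: norm_of_int simp flip: of_int_abs)
    also have "\<dots> = cmod (poly (of_int_poly q) (complex_of_real \<beta>)) *
        (\<Prod>z\<in>S - {of_real \<beta>}. cmod (poly (of_int_poly q) z))"
      using finS \<beta>S by (simp add: prod.remove norm_mult prod_norm)
    also have "cmod (poly (of_int_poly q) (complex_of_real \<beta>)) = \<bar>\<Sum>i\<le>R. of_int (c i) * \<beta> ^ i\<bar>"
      unfolding ev_real norm_of_real q ..
    also have "(\<Prod>z\<in>S - {of_real \<beta>}. cmod (poly (of_int_poly q) z)) \<le> (\<Prod>z\<in>S - {of_real \<beta>}. B)"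
    proof (intro prod_mono conjI)
      fix z assume z: "z \<in> S - {of_real \<beta>}"
      have "cmod (poly (of_int_poly q) z) \<le> (\<Sum>i\<le>R. cmod (of_int (c i) * z ^ i))"
        unfolding q by (rule norm_sum)
      also have "\<dots> \<le> (\<Sum>i\<le>R. of_int \<bar>c i\<bar>)"
        using le1[OF z] by (intro sum_mono) (auto simp: norm_mult norm_power norm_of_int power_le_one intro!: mult_left_le)
      also have "\<dots> \<le> B" by (simp add: B_def)
      finally show "cmod (poly (of_int_poly q) z) \<le> B" .
    qed auto
    finally show "1 \<le> \<bar>\<Sum>i\<le>R. of_int (c i) * \<beta> ^ i\<bar> *
        (1 + (\<Sum>i\<le>R. of_int \<bar>c i\<bar>)) ^ card (S - {complex_of_real \<beta>})"
      by (simp add: B_def mult_left_mono)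
  qed
qed

section \<open>Power series with few nonzero coefficients\<close>

text \<open>Picking a point of \<open>Z\<close> from each of the \<open>card Z + 1\<close>
  consecutive disjoint blocks would give more points than \<open>Z\<close> has.\<close>

lemma pigeonhole_free_block:
  fixes Z :: "nat set"
  assumes "finite Z"
  obtains j where "j \<le> card Z" "Z \<inter> {a + j * r<..a + Suc j * r} = {}"
proof (rule ccontr)
  assume "\<not> thesis"
  hence "\<forall>j\<in>{..card Z}. \<exists>z. z \<in> Z \<inter> {a + j * r<..a + Suc j * r}"
    using that by (metis atMost_iff ex_in_conv)
  then obtain z where z: "\<And>j. j \<le> card Z \<Longrightarrow> z j \<in> Z \<inter> {a + j * r<..a + Suc j * r}"
    by (metis atMost_iff)
  have less: "z i < z j" if "i < j" "j \<le> card Z" for i j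
  proof -
    have "z i \<le> a + Suc i * r" using z[of i] that by auto
    also have "\<dots> \<le> a + j * r" using that by (intro add_left_mono mult_right_mono) auto
    also have "\<dots> < z j" using z[of j] that by auto
    finally show ?thesis .
  qed
  have "inj_on z {..card Z}"
    by (intro inj_onI) (metis atMost_iff less less_irrefl linorder_neqE_nat)
  hence "card {..card Z} \<le> card Z"
    using z assms by (intro card_inj_on_le[of z]) auto
  thus False by simp
qed

text \<open>
  A weak form of isolation suffices: around \<open>m\<close> only a constant sign is required, not the absence of
  other nonzero coefficients.
\<close>

lemma no_isolated_positive_coefficient:
  fixes \<beta> :: real and c :: "nat \<Rightarrow> int"
  assumes \<beta>: "\<beta> > 1"
    and lower: "\<And>(d :: nat \<Rightarrow> int) R. (\<Sum>i\<le>R. of_int (d i) * \<beta> ^ i) \<noteq> 0 \<Longrightarrow>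
       1 \<le> \<bar>\<Sum>i\<le>R. of_int (d i) * \<beta> ^ i\<bar> * (1 + (\<Sum>i\<le>R. of_int \<bar>d i\<bar>)) ^ D"
    and zero: "(\<lambda>n. of_int (c n) * inverse \<beta> ^ n) sums 0"
    and growth: "\<forall>\<^sub>F N in sequentially. 1 + (\<Sum>i\<le>N. real_of_int \<bar>c i\<bar>) \<le> real N powr (1/4)"
  shows "\<forall>\<^sub>F N in sequentially. \<forall>m H. real N powr (1/2) \<le> real H \<and> H \<le> m \<and> m + H \<le> N \<and>
    (\<forall>n\<in>{m - H<..<m + H}. c n \<ge> 0) \<longrightarrow> c m \<le> 0"
proof -
  define x where "x = inverse \<beta>"
  have x: "0 < x" "x < 1" using \<beta> by (auto simp: x_def field_simps)
  define S where "S N = 1 + (\<Sum>i\<le>N. real_of_int \<bar>c i\<bar>)" for N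
  have S_mono: "S i \<le> S j" if "i \<le> j" for i j
    unfolding S_def using that by (intro add_left_mono sum_mono2) auto
  have S1: "S i \<ge> 1" for i unfolding S_def by (auto intro: sum_nonneg)
  have cS: "\<bar>c n\<bar> \<le> S n" for n
    using member_le_sum[of n "{..n}" "\<lambda>i. real_of_int \<bar>c i\<bar>"] unfolding S_def by simp
  \<comment> \<open>A crude linear bound valid for every index, including the small ones not covered
    by \<open>growth\<close>; it gives absolute convergence of all tails.\<close>
  obtain A where A: "A \<ge> 1" "\<And>n. \<bar>c n\<bar> \<le> A * (real n + 1)"
  proof -
    obtain n0 where n0: "\<And>n. n \<ge> n0 \<Longrightarrow> S n \<le> real n powr (1/4)"
      using growth unfolding S_def eventually_sequentially by blast
    have "\<bar>c n\<bar> \<le> S n0 * (real n + 1)" for n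
    proof (cases "n \<ge> n0 \<and> n \<ge> 1")
      case True
      have "\<bar>c n\<bar> \<le> real n powr (1/4)" using n0[of n] cS[of n] True by linarith
      also have "\<dots> \<le> real n powr 1" using True by (intro powr_mono) auto
      also have "\<dots> \<le> 1 * (real n + 1)" using True by simp
      also have "\<dots> \<le> S n0 * (real n + 1)" by (intro mult_right_mono S1) auto
      finally show ?thesis .
    next
      case False
      hence "S n \<le> S n0" by (intro S_mono) auto
      hence "\<bar>c n\<bar> \<le> S n0 * 1" using cS[of n] by simp
      also have "\<dots> \<le> S n0 * (real n + 1)" using S1[of n0] by (intro mult_left_mono) auto
      finally show ?thesis .
    qed
    thus ?thesis using that[of "S n0"] S1 by auto
  qed
  have summ: "summable (\<lambda>j. (real j + 2) * x ^ Suc j)"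
  proof -
    have "summable (\<lambda>n. of_nat (Suc n) * x ^ n)"
      using geometric_deriv_sums[of x] x by (auto simp: sums_iff)
    hence "summable (\<lambda>n. of_nat (Suc (Suc n)) * x ^ Suc n)"
      by (subst summable_Suc_iff)
    thus ?thesis by (simp add: algebra_simps)
  qed
  define A' where "A' = A * (suminf (\<lambda>j. (real j + 2) * x ^ Suc j))"
  have A'0: "A' > 0"
    unfolding A'_def using A(1) x summ by (intro mult_pos_pos suminf_pos) auto
  txt \<open>\<open>Y R\<close> is \<open>\<beta>\<^sup>R\<close> times the tail of the series after \<open>R\<close>; as the full series vanishes, it is also
    minus an integer polynomial in \<open>\<beta>\<close>, to which the hypothesis \<open>lower\<close> applies.\<close>
  define Y where "Y R = (suminf (\<lambda>j. of_int (c (R + Suc j)) * x ^ Suc j))" for R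
  have term_le: "\<bar>of_int (c (R + Suc j)) * x ^ Suc j\<bar> \<le> A * (real R + 1) * ((real j + 2) * x ^ Suc j)" for R j
  proof -
    have "\<bar>c (R + Suc j)\<bar> \<le> A * (real R + real j + 2)"
      using A(2)[of "R + Suc j"] by (simp add: algebra_simps)
    also have "\<dots> \<le> A * ((real R + 1) * (real j + 2))"
      using A(1) by (intro mult_left_mono) (auto simp: algebra_simps)
    finally have "real_of_int \<bar>c (R + Suc j)\<bar> * x ^ Suc j \<le> A * ((real R + 1) * (real j + 2)) * x ^ Suc j"
      using x by (intro mult_right_mono) auto
    thus ?thesis using x by (simp add: abs_mult algebra_simps)
  qed
  have summR: "summable (\<lambda>j. A * (real R + 1) * ((real j + 2) * x ^ Suc j))" for R
    using summ by (rule summable_mult)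
  have summY: "summable (\<lambda>j. \<bar>of_int (c (R + Suc j)) * x ^ Suc j\<bar>)" for R
    by (rule summable_comparison_test'[OF summR[of R], of 0]) (use term_le[of R] in auto)
  have Y_le: "\<bar>Y R\<bar> \<le> A' * (real R + 1)" for R
  proof -
    have "\<bar>Y R\<bar> \<le> (suminf (\<lambda>j. \<bar>of_int (c (R + Suc j)) * x ^ Suc j\<bar>))"
      unfolding Y_def by (rule summable_rabs[OF summY])
    also have "\<dots> \<le> (suminf (\<lambda>j. A * (real R + 1) * ((real j + 2) * x ^ Suc j)))"
      by (intro suminf_le term_le summY summR)
    also have "\<dots> = A' * (real R + 1)"
      unfolding A'_def by (subst suminf_mult[OF summ]) simp
    finally show ?thesis .
  qed
  have Y_rec: "Y R = x ^ W * Y (R + W) + (\<Sum>j<W. of_int (c (R + Suc j)) * x ^ Suc j)" for R W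
  proof -
    have "Y R = (suminf (\<lambda>j. of_int (c (R + Suc (j + W))) * x ^ Suc (j + W))) +
        (\<Sum>j<W. of_int (c (R + Suc j)) * x ^ Suc j)"
      unfolding Y_def
      by (rule suminf_split_initial_segment) (rule summable_rabs_cancel[OF summY])
    also have "(suminf (\<lambda>j. of_int (c (R + Suc (j + W))) * x ^ Suc (j + W))) =
        (suminf (\<lambda>j. x ^ W * (of_int (c ((R + W) + Suc j)) * x ^ Suc j)))"
      by (intro suminf_cong) (simp add: power_add algebra_simps)
    also have "\<dots> = x ^ W * Y (R + W)"
      unfolding Y_def by (rule suminf_mult[OF summable_rabs_cancel[OF summY]])
    finally show ?thesis .
  qed
  have Y_fin: "Y R = - (\<Sum>i\<le>R. of_int (c (R - i)) * \<beta> ^ i)" for R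
  proof -
    have "0 = (suminf (\<lambda>n. of_int (c n) * x ^ n))" using zero by (simp add: sums_iff x_def)
    also have "\<dots> = (suminf (\<lambda>n. of_int (c (n + Suc R)) * x ^ (n + Suc R))) + (\<Sum>i<Suc R. of_int (c i) * x ^ i)"
      by (rule suminf_split_initial_segment) (use zero in \<open>auto simp: sums_iff x_def\<close>)
    also have "(suminf (\<lambda>n. of_int (c (n + Suc R)) * x ^ (n + Suc R))) =
        (suminf (\<lambda>n. x ^ R * (of_int (c (R + Suc n)) * x ^ Suc n)))"
      by (intro suminf_cong) (simp add: power_add algebra_simps)
    also have "\<dots> = x ^ R * Y R"
      unfolding Y_def by (rule suminf_mult[OF summable_rabs_cancel[OF summY]])
    finally have "x ^ R * Y R = - (\<Sum>i\<le>R. of_int (c i) * x ^ i)"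
      by (simp add: lessThan_Suc_atMost)
    hence "\<beta> ^ R * (x ^ R * Y R) = - (\<Sum>i\<le>R. of_int (c i) * (\<beta> ^ R * x ^ i))"
      by (simp add: sum_distrib_left algebra_simps)
    also have "(\<Sum>i\<le>R. of_int (c i) * (\<beta> ^ R * x ^ i)) = (\<Sum>i\<le>R. of_int (c i) * \<beta> ^ (R - i))"
      using \<beta> by (intro sum.cong refl) (auto simp: x_def power_diff field_simps)
    also have "\<dots> = (\<Sum>i\<le>R. of_int (c (R - i)) * \<beta> ^ i)"
      by (rule sum.reindex_bij_witness[of _ "\<lambda>i. R - i" "\<lambda>i. R - i"]) auto
    finally show ?thesis using \<beta> by (simp add: x_def power_inverse field_simps)
  qed
  have Y_low: "1 \<le> \<bar>Y R\<bar> * S R ^ D" if "Y R \<noteq> 0" for R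
  proof -
    have "(\<Sum>i\<le>R. real_of_int \<bar>c (R - i)\<bar>) = (\<Sum>i\<le>R. real_of_int \<bar>c i\<bar>)"
      by (rule sum.reindex_bij_witness[of _ "\<lambda>i. R - i" "\<lambda>i. R - i"]) auto
    thus ?thesis using lower[where d = "\<lambda>i. c (R - i)" and R = R] that
      unfolding S_def by (simp add: Y_fin)
  qed

  have e1: "\<forall>\<^sub>F N in sequentially. S N \<le> real N powr (1/4)"
    using growth unfolding S_def .
  \<comment> \<open>Zero blocks will have length about \<open>N powr (1/8)\<close>. At most about
    \<open>N powr (1/4)\<close> of them are needed, so they fit into an interval of length
    \<open>N powr (1/2)\<close>, while \<open>x\<close> raised to a block length still beats every
    fixed power of \<open>N\<close>.\<close>
  have e2: "\<forall>\<^sub>F N in sequentially. (real N powr (1/8) + 1) * (real N powr (1/4) + 1) + 1 \<le> real N powr (1/2)"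
    by real_asymp
  have e3: "\<forall>\<^sub>F N in sequentially. x powr (real N powr (1/8)) * (A' * (real N + 1)) * (real N powr (1/4)) ^ D < 1"
  proof -
    have "((\<lambda>N. exp (ln x * (real N powr (1/8))) * (A' * (real N + 1)) * (real N powr (real D/4))) \<longlongrightarrow> 0) sequentially"
      using A'0 x by real_asymp
    hence "\<forall>\<^sub>F N in sequentially. exp (ln x * (real N powr (1/8))) * (A' * (real N + 1)) * (real N powr (real D/4)) < 1"
      by (rule order_tendstoD) simp
    thus ?thesis using eventually_gt_at_top[of 0]
      by eventually_elim (use x in \<open>auto simp: powr_def mult.commute simp flip: exp_of_nat_mult\<close>)
  qed
  show ?thesis using e1 e2 e3
  proof eventually_elim
    case (elim N)
    note a1 = elim(1) and a2 = elim(2) and a3 = elim(3)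
    show ?case
    proof (intro allI impI, elim conjE, rule ccontr)
      fix m H
      assume H: "real N powr (1/2) \<le> real H" "H \<le> m" "m + H \<le> N"
        and pos: "\<forall>n\<in>{m - H<..<m + H}. c n \<ge> 0" and cm: "\<not> c m \<le> 0"
      define r where "r = nat \<lceil>real N powr (1/8)\<rceil>"
      have r: "real N powr (1/8) \<le> r" "r \<le> real N powr (1/8) + 1"
        unfolding r_def using powr_ge_zero[of "real N" "1/8"] by linarith+
      have N1: "real N powr (1/4) \<ge> 1" using a1 S1[of N] by linarith
      have xr: "x ^ r * (A' * (real N + 1)) * (real N powr (1/4)) ^ D < 1"
      proof -
        have "x ^ r = x powr real r" using x by (simp add: powr_realpow)
        also have "\<dots> \<le> x powr (real N powr (1/8))" using x r by (intro powr_mono') auto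
        finally have "x ^ r * (A' * (real N + 1)) * (real N powr (1/4)) ^ D \<le>
            x powr (real N powr (1/8)) * (A' * (real N + 1)) * (real N powr (1/4)) ^ D"
          using A'0 by (intro mult_right_mono) auto
        with a3 show ?thesis by linarith
      qed
      have xr': "x ^ r * (A' * (real N + 1)) < 1"
      proof -
        have "x ^ r * (A' * (real N + 1)) * 1 \<le> x ^ r * (A' * (real N + 1)) * (real N powr (1/4)) ^ D"
          using A'0 x N1 by (intro mult_left_mono one_le_power) auto
        with xr show ?thesis by linarith
      qed
      have Y_leN: "\<bar>Y R\<bar> \<le> A' * (real N + 1)" if "R \<le> N" for R
      proof -
        have "A' * (real R + 1) \<le> A' * (real N + 1)" using A'0 that by simp
        with Y_le[of R] show ?thesis by linarith
      qed
      define Z where "Z = {n. n \<le> N \<and> c n \<noteq> 0}"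
      have finZ: "finite Z" unfolding Z_def by auto
      have cardZ: "real (card Z) \<le> S N"
      proof -
        have "real (card Z) = (\<Sum>n\<in>Z. 1)" by simp
        also have "\<dots> \<le> (\<Sum>n\<in>Z. real_of_int \<bar>c n\<bar>)" by (intro sum_mono) (auto simp: Z_def)
        also have "\<dots> \<le> (\<Sum>n\<le>N. real_of_int \<bar>c n\<bar>)" by (intro sum_mono2) (auto simp: Z_def)
        finally show ?thesis by (simp add: S_def)
      qed
      have "real r * (real (card Z) + 1) \<le> (real N powr (1/8) + 1) * (real N powr (1/4) + 1)"
        using r cardZ a1 by (intro mult_mono) auto
      hence "real r * (real (card Z) + 1) + 1 \<le> real H" using a2 H(1) by linarith
      hence "real (r * (card Z + 1) + 1) \<le> real H" by (simp add: algebra_simps)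
      hence rH: "r * (card Z + 1) + 1 \<le> H" by linarith
      have "r \<le> r * (card Z + 1)" by simp
      hence rH': "r \<le> H - 1" using rH by linarith
      \<comment> \<open>The coefficient at \<open>m\<close> contributes at least
        \<open>x ^ (m - R)\<close>, the other terms before \<open>m + H\<close> are nonnegative, and
        what follows is smaller than this contribution by a factor coming from
        \<open>x ^ (H - 1)\<close>.\<close>
      have Ypos: "Y R > 0" if R: "m - H \<le> R" "R < m" for R
      proof -
        define W where "W = m + H - 1 - R"
        have W: "W = (m - R) + (H - 1)" "R + W \<le> N" using R H rH by (auto simp: W_def)
        have "1 * x ^ (m - R) \<le> real_of_int (c m) * x ^ (m - R)"
          using cm x by (intro mult_right_mono) auto
        hence "x ^ (m - R) \<le> (\<Sum>j\<in>{m - Suc R}. of_int (c (R + Suc j)) * x ^ Suc j)"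
          using R by (simp only: sum.insert_if sum.empty finite.emptyI empty_iff if_False
            Suc_diff_Suc le_add_diff_inverse less_imp_le)
        also have "\<dots> \<le> (\<Sum>j<W. of_int (c (R + Suc j)) * x ^ Suc j)"
          using R rH x pos H by (intro sum_mono2) (auto simp: W_def)
        finally have 1: "x ^ (m - R) \<le> (\<Sum>j<W. of_int (c (R + Suc j)) * x ^ Suc j)" .
        have "\<bar>Y (R + W)\<bar> \<le> A' * (real N + 1)"
          using W(2) by (rule Y_leN)
        hence "\<bar>x ^ W * Y (R + W)\<bar> \<le> x ^ W * (A' * (real N + 1))"
          using x by (simp add: abs_mult mult_left_mono)
        also have "\<dots> = x ^ (m - R) * x ^ (H - 1) * (A' * (real N + 1))"
          using W(1) by (simp add: power_add)
        also have "\<dots> \<le> x ^ (m - R) * x ^ r * (A' * (real N + 1))"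
          using x A'0 rH' by (intro mult_right_mono mult_left_mono power_decreasing) auto
        also have "\<dots> < x ^ (m - R)" using xr' x by (simp add: mult.assoc)
        finally show ?thesis using 1 Y_rec[of R W] by linarith
      qed
      txt \<open>A long block of zero coefficients makes \<open>Y R\<close> too small for a nonzero value.\<close>
      obtain j where j: "j \<le> card Z" "Z \<inter> {m - H + j * r<..m - H + Suc j * r} = {}"
        using pigeonhole_free_block[OF finZ] by metis
      define R where "R = m - H + j * r"
      have "Suc j * r \<le> (card Z + 1) * r" using j(1) by (intro mult_right_mono) auto
      hence "Suc j * r + 1 \<le> H" using rH mult.commute[of r "card Z + 1"] by linarith
      moreover have "R + r = (m - H) + Suc j * r" by (simp add: R_def)
      ultimately have Rm: "R + r < m" using H(2) by linarith
      have c0: "c (R + Suc i) = 0" if "i < r" for i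
      proof -
        have "R + Suc i \<notin> Z" using j(2) that by (auto simp: R_def)
        thus ?thesis using Rm that H(3) by (auto simp: Z_def)
      qed
      have "Y R = x ^ r * Y (R + r)" using Y_rec[of R r] c0 by simp
      moreover have "\<bar>Y (R + r)\<bar> \<le> A' * (real N + 1)"
        using Rm H by (intro Y_leN) auto
      ultimately have "\<bar>Y R\<bar> \<le> x ^ r * (A' * (real N + 1))"
        using x by (simp add: abs_mult mult_left_mono)
      moreover have "S R ^ D \<le> (real N powr (1/4)) ^ D"
        using S_mono[of R N] a1 Rm H S1[of R] by (intro power_mono) auto
      ultimately have "\<bar>Y R\<bar> * S R ^ D \<le> x ^ r * (A' * (real N + 1)) * (real N powr (1/4)) ^ D"
        using x A'0 S1[of R] by (intro mult_mono) auto
      moreover have "Y R > 0" using Rm by (intro Ypos) (auto simp: R_def)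
      ultimately show False using Y_low[of R] xr by auto
    qed
  qed
qed

section \<open>Products of the series\<close>

text \<open>The index \<open>0\<close> accounts for the summand \<open>1\<close> of \<^const>\<open>xi\<close>.\<close>

definition psi :: "real \<Rightarrow> nat \<Rightarrow> nat" where
  "psi y m = (if m = 0 then 0 else nat \<lfloor>phi y (real m)\<rfloor>)"

lemma psi_le_phi: "m > 0 \<Longrightarrow> real (psi y m) \<le> phi y (real m)"
  by (simp add: psi_def phi_def)

lemma psi_ge_phi: "m > 0 \<Longrightarrow> phi y (real m) - 1 \<le> real (psi y m)"
proof -
  assume "m > 0"
  have "phi y (real m) - 1 \<le> of_int \<lfloor>phi y (real m)\<rfloor>" by linarith
  also have "\<dots> \<le> real (nat \<lfloor>phi y (real m)\<rfloor>)" by linarith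
  finally show ?thesis using \<open>m > 0\<close> by (simp add: psi_def)
qed

text \<open>For \<open>m \<ge> 3\<close> the logarithm is at least 1, so
  \<open>phi y m \<ge> m\<close>. The successor absorbs \<open>m = 2\<close>, where the integral
  part can be 1.\<close>

lemma le_Suc_psi:
  assumes "y \<ge> 0"
  shows "m \<le> Suc (psi y m)"
proof -
  consider "m \<le> 1" | "m = 2" | "m \<ge> 3" by linarith
  thus ?thesis
  proof cases
    case 2
    have "1 \<le> phi y 2" by (simp add: phi_def)
    thus ?thesis using 2 by (simp add: psi_def le_nat_iff le_floor_iff)
  next
    case 3
    have "exp 1 \<le> real m" using exp_le 3 by linarith
    hence "1 \<le> ln (real m)" using 3 by (subst ln_ge_iff) auto
    hence "ln (real m) powr 1 \<le> ln (real m) powr (1 + y)" using assms by (intro powr_mono) auto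
    hence "exp (ln (real m)) \<le> phi y (real m)" using \<open>1 \<le> ln (real m)\<close> by (simp add: phi_def)
    hence "real m \<le> phi y (real m)" using 3 by simp
    hence "m \<le> nat \<lfloor>phi y (real m)\<rfloor>" by (simp add: le_nat_iff le_floor_iff phi_def)
    thus ?thesis using 3 by (simp add: psi_def)
  qed auto
qed

lemma finite_psi_le: "y \<ge> 0 \<Longrightarrow> finite {m. psi y m \<le> N}"
proof (rule finite_subset)
  assume "y \<ge> 0"
  show "{m. psi y m \<le> N} \<subseteq> {..Suc N}"
  proof
    fix m assume "m \<in> {m. psi y m \<le> N}"
    thus "m \<in> {..Suc N}" using le_Suc_psi[OF \<open>y \<ge> 0\<close>, of m] by simp
  qed
qed simp

text \<open>Inverting \<open>phi\<close> bounds the admissible indices; \<open>N + 1\<close>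
  accounts for the integral part and the factor 2 for the extra index 0.\<close>

lemma card_psi_le:
  assumes "y \<ge> 0"
  shows "real (card {m. psi y m \<le> N}) \<le> 2 * exp (ln (real N + 1) powr (1 / (1 + y)))"
proof -
  define E where "E = exp (ln (real N + 1) powr (1 / (1 + y)))"
  have E1: "E \<ge> 1" by (simp add: E_def)
  have "real m \<le> E" if "psi y m \<le> N" for m
  proof (cases "m = 0")
    case False
    hence m: "m > 0" by simp
    have "exp (ln (real m) powr (1 + y)) < real N + 1"
    proof -
      have "\<lfloor>exp (ln (real m) powr (1 + y))\<rfloor> \<le> int N"
        using that m by (simp add: psi_def phi_def nat_le_iff)
      thus ?thesis by linarith
    qed
    hence "ln (real m) powr (1 + y) \<le> ln (real N + 1)"
      by (subst ln_ge_iff) auto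
    hence "(ln (real m) powr (1 + y)) powr (1 / (1 + y)) \<le> ln (real N + 1) powr (1 / (1 + y))"
      using assms by (intro powr_mono2) auto
    hence "ln (real m) \<le> ln (real N + 1) powr (1 / (1 + y))"
      using assms m by (simp add: powr_powr)
    hence "exp (ln (real m)) \<le> E" unfolding E_def by simp
    thus ?thesis using m by simp
  qed (use E1 in auto)
  hence "{m. psi y m \<le> N} \<subseteq> {..nat \<lfloor>E\<rfloor>}" by (auto intro: le_nat_floor)
  hence "card {m. psi y m \<le> N} \<le> card {..nat \<lfloor>E\<rfloor>}" by (intro card_mono) auto
  hence "real (card {m. psi y m \<le> N}) \<le> real (nat \<lfloor>E\<rfloor>) + 1" by simp
  also have "\<dots> \<le> E + 1" using E1 by simp
  also have "\<dots> \<le> 2 * E" using E1 by simp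
  finally show ?thesis by (simp add: E_def)
qed

text \<open>These are the power series coefficients of \<open>xi y\<close>. Fibres are counted
  because \<open>psi y\<close> need not be injective: for \<open>y > 0\<close> both 1 and 2 are sent
  to 1.\<close>

definition digit :: "real \<Rightarrow> nat \<Rightarrow> nat" where
  "digit y n = card {m. psi y m = n}"

lemma sum_over_digit:
  fixes f :: "nat \<Rightarrow> 'a :: comm_semiring_1"
  assumes "y \<ge> 0"
  shows "(\<Sum>n\<le>N. of_nat (digit y n) * f n) = (\<Sum>m | psi y m \<le> N. f (psi y m))"
proof -
  have "(\<Sum>m | psi y m \<le> N. f (psi y m)) =
      (\<Sum>n\<le>N. \<Sum>m | m \<in> {m. psi y m \<le> N} \<and> psi y m = n. f (psi y m))"
    using finite_psi_le[OF assms] by (intro sum.group[symmetric]) auto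
  also have "\<dots> = (\<Sum>n\<le>N. of_nat (digit y n) * f n)"
  proof (intro sum.cong refl)
    fix n assume "n \<in> {..N}"
    hence "{m. m \<in> {m. psi y m \<le> N} \<and> psi y m = n} = {m. psi y m = n}" by auto
    thus "(\<Sum>m | m \<in> {m. psi y m \<le> N} \<and> psi y m = n. f (psi y m)) = of_nat (digit y n) * f n"
      by (simp add: digit_def)
  qed
  finally show ?thesis ..
qed

lemma digit_pos: "y \<ge> 0 \<Longrightarrow> digit y (psi y m) > 0"
  unfolding digit_def using finite_psi_le[of y "psi y m"]
  by (auto simp: card_gt_0_iff elim: finite_subset[rotated])

text \<open>The sum over indices converges absolutely, so it may be regrouped by exponent: the
  finite sets of indices with exponent at most \<open>N\<close> exhaust the naturals.\<close>

lemma digit_sums_xi: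
  assumes "y \<ge> 0" "0 < x" "x < 1"
  shows "(\<lambda>n. real (digit y n) * x ^ n) sums xi y x"
proof -
  have "summable (\<lambda>m. x ^ (m - 1))"
    using summable_geometric[of x] assms by (subst summable_Suc_iff[symmetric]) simp
  hence summ: "summable (\<lambda>m. x ^ psi y m)"
  proof (rule summable_comparison_test'[of _ 0])
    fix m :: nat
    show "norm (x ^ psi y m) \<le> x ^ (m - 1)"
      using assms le_Suc_psi[OF assms(1), of m] by (auto intro!: power_decreasing)
  qed
  have "suminf (\<lambda>m. x ^ psi y m) = xi y x"
    using suminf_split_head[OF summ] by (simp add: xi_def psi_def)
  hence "((\<lambda>m. x ^ psi y m) has_sum xi y x) UNIV"
    using summ assms by (intro norm_summable_imp_has_sum) (auto simp: sums_iff)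
  hence lim: "(sum (\<lambda>m. x ^ psi y m) \<longlongrightarrow> xi y x) (finite_subsets_at_top UNIV)"
    by (simp add: has_sum_def)
  have "filterlim (\<lambda>N. {m. psi y m \<le> N}) (finite_subsets_at_top UNIV) sequentially"
    unfolding filterlim_finite_subsets_at_top
  proof (intro allI impI)
    fix X :: "nat set" assume "finite X \<and> X \<subseteq> UNIV"
    hence "finite X" by simp
    have "X \<subseteq> {m. psi y m \<le> N}" if "N \<ge> Max (psi y ` X)" for N
    proof
      fix m assume "m \<in> X"
      hence "psi y m \<le> Max (psi y ` X)" using \<open>finite X\<close> by (intro Max_ge) auto
      thus "m \<in> {m. psi y m \<le> N}" using that by simp
    qed
    then show "\<forall>\<^sub>F N in sequentially. finite {m. psi y m \<le> N} \<and> X \<subseteq> {m. psi y m \<le> N} \<and> {m. psi y m \<le> N} \<subseteq> UNIV"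
      unfolding eventually_sequentially using finite_psi_le[OF assms(1)] by blast
  qed
  from filterlim_compose[OF lim this]
  have "(\<lambda>N. \<Sum>m | psi y m \<le> N. x ^ psi y m) \<longlonglongrightarrow> xi y x" .
  thus ?thesis using sum_over_digit[OF assms(1), where f = "\<lambda>n. x ^ n"] by (simp add: sums_def_le)
qed

text \<open>The coefficients of the product of the series over the list, built by Cauchy products;
  repeated entries stand for powers.\<close>

fun rep :: "real list \<Rightarrow> nat \<Rightarrow> nat" where
  "rep [] n = of_bool (n = 0)"
| "rep (y # ys) n = (\<Sum>j\<le>n. digit y j * rep ys (n - j))"

lemma rep_Cons_pos:
  assumes "y \<ge> 0" "rep ys n > 0"
  shows "rep (y # ys) (psi y m + n) > 0"
proof -
  have "0 < digit y (psi y m) * rep ys ((psi y m + n) - psi y m)"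
    using assms digit_pos by simp
  also have "\<dots> \<le> rep (y # ys) (psi y m + n)"
    unfolding rep.simps by (rule member_le_sum) auto
  finally show ?thesis .
qed

lemma rep_sums:
  assumes "\<forall>y\<in>set ys. y \<ge> 0" "0 < x" "x < 1"
  shows "(\<lambda>n. real (rep ys n) * x ^ n) sums (\<Prod>y\<leftarrow>ys. xi y x)"
  using assms(1)
proof (induction ys)
  case Nil
  have "(\<lambda>n. real (rep [] n) * x ^ n) = (\<lambda>n. if n = 0 then 1 else 0)" by auto
  thus ?case using sums_single[of 0 "\<lambda>_. 1 :: real"] by simp
next
  case (Cons y ys)
  have d: "(\<lambda>n. real (digit y n) * x ^ n) sums xi y x" using Cons.prems assms by (intro digit_sums_xi) auto
  have r: "(\<lambda>n. real (rep ys n) * x ^ n) sums (\<Prod>y\<leftarrow>ys. xi y x)" using Cons by simp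
  have "(\<lambda>k. \<Sum>i\<le>k. (real (digit y i) * x ^ i) * (real (rep ys (k - i)) * x ^ (k - i))) sums
      (suminf (\<lambda>k. real (digit y k) * x ^ k) * suminf (\<lambda>k. real (rep ys k) * x ^ k))"
    using d r assms by (intro Cauchy_product_sums) (auto simp: sums_iff abs_mult)
  also have "(\<lambda>k. \<Sum>i\<le>k. (real (digit y i) * x ^ i) * (real (rep ys (k - i)) * x ^ (k - i))) =
      (\<lambda>k. real (rep (y # ys) k) * x ^ k)"
  proof
    fix k
    have "(\<Sum>i\<le>k. (real (digit y i) * x ^ i) * (real (rep ys (k - i)) * x ^ (k - i))) =
       (\<Sum>i\<le>k. real (digit y i * rep ys (k - i)) * x ^ k)"
      by (intro sum.cong refl) (auto simp flip: power_add)
    thus "(\<Sum>i\<le>k. (real (digit y i) * x ^ i) * (real (rep ys (k - i)) * x ^ (k - i))) =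
        real (rep (y # ys) k) * x ^ k"
      by (simp add: sum_distrib_right)
  qed
  finally show ?case using d r by (simp add: sums_iff)
qed

text \<open>The triangle \<open>i + j \<le> N\<close> of a Cauchy product is enlarged to a square,
  over which the sum factors.\<close>

lemma sum_rep_le: "(\<Sum>n\<le>N. rep ys n) \<le> (\<Prod>y\<leftarrow>ys. \<Sum>n\<le>N. digit y n)"
proof (induction ys)
  case (Cons y ys)
  have "(\<Sum>n\<le>N. rep (y # ys) n) = (\<Sum>(i,j)\<in>{(i,j). i + j \<le> N}. digit y i * rep ys j)"
    by (simp add: sum.triangle_reindex_eq)
  also have "\<dots> \<le> (\<Sum>(i,j)\<in>{..N} \<times> {..N}. digit y i * rep ys j)"
    by (intro sum_mono2) auto
  also have "\<dots> = (\<Sum>n\<le>N. digit y n) * (\<Sum>n\<le>N. rep ys n)"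
    by (simp add: sum_product sum.cartesian_product)
  finally show ?case using Cons.IH by (auto intro: order_trans)
qed auto

text \<open>
  Up to bounded factors, \<open>exp (weight ys (ln N))\<close> is the number of exponents up to \<open>N\<close> occurring in
  the product of the series, counted with multiplicity.
\<close>

definition weight :: "real list \<Rightarrow> real \<Rightarrow> real" where
  "weight ys L = (\<Sum>y\<leftarrow>ys. L powr (1 / (1 + y)))"

lemma weight_Nil [simp]: "weight [] L = 0"
  and weight_Cons [simp]: "weight (y # ys) L = L powr (1 / (1 + y)) + weight ys L"
  by (simp_all add: weight_def)

lemma sum_rep_le_exp:
  assumes "\<forall>y\<in>set ys. y \<ge> 0"
  shows "(\<Sum>n\<le>N. real (rep ys n)) \<le> 2 ^ length ys * exp (weight ys (ln (real N + 1)))"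
proof -
  have "real (\<Prod>y\<leftarrow>ys. \<Sum>n\<le>N. digit y n) \<le> 2 ^ length ys * exp (weight ys (ln (real N + 1)))"
    using assms
  proof (induction ys)
    case (Cons y ys)
    have "real (\<Sum>n\<le>N. digit y n) = real (card {m. psi y m \<le> N})"
      using sum_over_digit[where f = "\<lambda>_. 1 :: nat", of y N] Cons.prems by simp
    also have "\<dots> \<le> 2 * exp (ln (real N + 1) powr (1 / (1 + y)))"
      using Cons.prems by (intro card_psi_le) auto
    finally have "real (\<Sum>n\<le>N. digit y n) * real (\<Prod>y\<leftarrow>ys. \<Sum>n\<le>N. digit y n) \<le>
        (2 * exp (ln (real N + 1) powr (1 / (1 + y)))) * (2 ^ length ys * exp (weight ys (ln (real N + 1))))"
      using Cons by (intro mult_mono) auto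
    thus ?case by (simp add: exp_add mult_ac del: of_nat_sum)
  qed auto
  moreover have "(\<Sum>n\<le>N. real (rep ys n)) \<le> real (\<Prod>y\<leftarrow>ys. \<Sum>n\<le>N. digit y n)"
    using sum_rep_le[of ys N] by (metis of_nat_mono of_nat_sum)
  ultimately show ?thesis by linarith
qed

section \<open>Greedy expansions\<close>

lemma ln_one_minus_ge:
  fixes t :: real
  assumes "0 \<le> t" "t \<le> 1/2"
  shows "ln (1 - t) \<ge> - 2 * t"
proof -
  have "ln (1 / (1 - t)) \<le> 1 / (1 - t) - 1" using assms by (intro ln_le_minus_one) auto
  also have "\<dots> = t / (1 - t)" using assms by (simp add: field_simps)
  also have "\<dots> \<le> t / (1/2)" using assms by (intro divide_left_mono) auto
  finally show ?thesis using assms by (simp add: ln_div)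
qed

lemma exp_minus_le:
  fixes t :: real
  assumes "0 \<le> t" "t \<le> 1"
  shows "exp (- t) \<le> 1 - t / 2"
proof -
  have "exp (-t) = 1 / exp t" by (simp add: exp_minus field_simps)
  also have "\<dots> \<le> 1 / (1 + t)" using assms exp_ge_add_one_self[of t] by (intro divide_left_mono) auto
  also have "\<dots> \<le> 1 - t / 2"
  proof -
    have "1 \<le> (1 - t / 2) * (1 + t)"
      using mult_mono[of t 1 t t] assms by (simp add: algebra_simps)
    thus ?thesis using assms by (simp add: field_simps)
  qed
  finally show ?thesis .
qed

text \<open>
  Here \<open>y \<ge> 1\<close> enters: it makes \<open>ln x powr (1 / (1 + y))\<close> at most \<open>sqrt (ln x)\<close>. By
  \<open>powr_loss_le\<close> below, replacing \<open>x\<close> by the remainder \<open>x - psi y m\<close> then changes weights only by a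
  bounded amount, so that the greedy expansion can be iterated.
\<close>

lemma psi_below:
  assumes y: "y \<ge> 1"
  obtains C x0 :: real where "C \<ge> 0"
    "\<And>x. x \<ge> x0 \<Longrightarrow> \<exists>m. real (psi y m) < x \<and>
       ln x - 2 * sqrt (ln x) \<le> ln (x - real (psi y m)) \<and>
       ln (x - real (psi y m)) \<le> ln x - ln x powr (1 / (1 + y)) + ln (ln x) + C"
proof -
  \<comment> \<open>The summand \<open>8 * (1 + y)\<close> comes from the relative error in
    \<open>phi_low\<close>, the summand 1 from rounding down in \<open>psi\<close>.\<close>
  define K where "K = 8 * (1 + y) + 1"
  have "filterlim (\<lambda>x. ln x powr (1 / (1 + y))) at_top (at_top :: real filter)"
    using y by real_asymp
  hence "\<forall>\<^sub>F x in at_top. ln x powr (1 / (1 + y)) \<ge> 3" by (simp add: filterlim_at_top)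
  hence "\<forall>\<^sub>F x in at_top. ln x powr (1 / (1 + y)) \<ge> 3 \<and> x > (1::real)"
    using eventually_gt_at_top by (rule eventually_conj)
  then obtain x0 where x0: "\<And>x. x \<ge> x0 \<Longrightarrow> ln x powr (1 / (1 + y)) \<ge> 3 \<and> x > 1"
    by (auto simp: eventually_at_top_linorder)
  show ?thesis
  proof (rule that[of "ln K" x0])
    show "ln K \<ge> 0" using y by (simp add: K_def)
    fix x assume x: "x \<ge> x0"
    define L where "L = ln x"
    \<comment> \<open>The real solution of \<open>phi y M = x\<close> is \<open>M = exp u\<close>,
      and \<open>t\<close> is its reciprocal, the relative effect of changing the index by
      one.\<close>
    define u where "u = L powr (1 / (1 + y))"
    define t where "t = exp (- u)"
    have u3: "u \<ge> 3" and x1: "x > 1" using x0[OF x] by (auto simp: u_def L_def)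
    have L0: "L > 0" using x1 by (simp add: L_def)
    have xL: "x = exp L" using x1 by (simp add: L_def)
    have uL: "u powr (1 + y) = L" using y L0 by (simp add: u_def powr_powr)
    have "u powr 1 \<le> u powr (1 + y)" using u3 y by (intro powr_mono) auto
    hence uleL: "u \<le> L" using uL u3 by simp
    have "L powr (1 / (1 + y)) \<le> L powr (1/2)" using y uleL u3 by (intro powr_mono) (auto simp: field_simps)
    hence usq: "u \<le> sqrt L" using L0 by (simp add: u_def powr_half_sqrt)
    have "exp 3 \<ge> (8 :: real)"
    proof -
      have "(2::real) ^ 3 \<le> exp 1 ^ 3" using exp_ge_add_one_self[of 1] by (intro power_mono) auto
      thus ?thesis by (simp flip: exp_of_nat_mult)
    qed
    also have "exp 3 \<le> exp u" using u3 by simp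
    finally have eu: "exp u \<ge> 8" .
    have t: "0 < t" "t \<le> 1/8" "t * exp u = 1"
      using eu by (auto simp: t_def exp_minus field_simps)
    have tu: "0 \<le> 1 - t / u" using t u3 by (simp add: field_simps)
    txt \<open>Stopping one step before the largest admissible index keeps the remainder from being too small.\<close>
    define m where "m = nat \<lfloor>exp u\<rfloor> - 1"
    have m: "exp u - 2 \<le> real m" "real m \<le> exp u - 1" "m > 0"
    proof -
      have "\<lfloor>exp u\<rfloor> \<ge> 8" using eu by (simp add: le_floor_iff)
      thus "exp u - 2 \<le> real m" "real m \<le> exp u - 1" "m > 0" unfolding m_def by linarith+
    qed
    have m1: "real m \<ge> 1" using m(3) by simp
    have lnm: "ln (real m) \<ge> 0" using m1 by simp
    have lnm_up: "ln (real m) \<le> u - t"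
    proof -
      have "real m \<le> exp u * (1 - t)" using m t by (simp add: algebra_simps)
      hence "ln (real m) \<le> ln (exp u * (1 - t))" using m1 by (intro ln_mono) (auto simp: m(3))
      also have "\<dots> = u + ln (1 - t)" using t by (simp add: ln_mult)
      also have "\<dots> \<le> u + (1 - t - 1)" using t by (intro add_left_mono ln_le_minus_one) auto
      finally show ?thesis by simp
    qed
    \<comment> \<open>Since \<open>m \<le> M - 1\<close>, the logarithm of \<open>m\<close> falls
      short of \<open>u\<close> by at least \<open>t\<close>. Raising to the power
      \<open>1 + y\<close> preserves this loss because \<open>u \<le> L\<close>, so a remainder of
      at least \<open>x * t / 2\<close> is left.\<close>
    have phi_up: "phi y (real m) \<le> x * (1 - t / 2)"
    proof -
      have "ln (real m) powr (1 + y) \<le> (u * (1 - t / u)) powr (1 + y)"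
        using lnm lnm_up u3 y by (intro powr_mono2) (auto simp: algebra_simps)
      also have "\<dots> = L * (1 - t / u) powr (1 + y)"
        using u3 t tu by (simp add: powr_mult uL)
      also have "\<dots> \<le> L * (1 - t / u) powr 1"
        using u3 t y L0 by (intro mult_left_mono powr_mono') (auto simp: field_simps)
      also have "\<dots> = L - t * (L / u)" using u3 t by (simp add: field_simps)
      also have "\<dots> \<le> L - t * 1" using u3 uleL t by (intro diff_left_mono mult_left_mono) (auto simp: field_simps)
      finally have "phi y (real m) \<le> exp (L - t)" by (simp add: phi_def)
      also have "\<dots> = x * exp (- t)" by (simp add: xL exp_diff exp_minus field_simps)
      also have "\<dots> \<le> x * (1 - t / 2)" using x1 t by (intro mult_left_mono exp_minus_le) auto
      finally show ?thesis .
    qed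
    \<comment> \<open>Since \<open>m \<ge> M - 2\<close>, the logarithm of \<open>m\<close> falls
      short of \<open>u\<close> by at most \<open>4 * t\<close>; both exponentials are then
      linearised from below.\<close>
    have phi_low: "phi y (real m) \<ge> x * (1 - 8 * (1 + y) * L * t)"
    proof -
      have "u - 4 * t \<le> ln (real m)"
      proof -
        have "u - 4 * t \<le> u + ln (1 - 2 * t)" using ln_one_minus_ge[of "2 * t"] t by simp
        also have "\<dots> = ln (exp u * (1 - 2 * t))" using t by (simp add: ln_mult)
        also have "\<dots> \<le> ln (real m)" using m t eu by (intro ln_mono) (auto simp: algebra_simps)
        finally show ?thesis .
      qed
      define s where "s = 4 * t / u"
      have s: "0 \<le> s" "s \<le> 1/2" "s \<le> 4 * t" using t u3 by (auto simp: s_def field_simps)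
      have "L - 8 * (1 + y) * L * t \<le> L * (1 + (1 + y) * (- 2 * s))"
      proof -
        have "L * (1 + y) * 2 * s \<le> L * (1 + y) * 2 * (4 * t)" using s L0 y by (intro mult_left_mono) auto
        thus ?thesis by (simp add: algebra_simps)
      qed
      also have "\<dots> \<le> L * exp ((1 + y) * (- 2 * s))"
        using L0 by (intro mult_left_mono exp_ge_add_one_self) auto
      also have "\<dots> \<le> L * exp ((1 + y) * ln (1 - s))"
      proof -
        have "(1 + y) * (- 2 * s) \<le> (1 + y) * ln (1 - s)"
          using y s by (intro mult_left_mono ln_one_minus_ge) auto
        thus ?thesis using L0 by simp
      qed
      also have "\<dots> = L * (1 - s) powr (1 + y)" using s by (simp add: powr_def)
      also have "\<dots> = (u * (1 - s)) powr (1 + y)" using s u3 by (simp add: powr_mult uL)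
      also have "\<dots> \<le> ln (real m) powr (1 + y)"
        using \<open>u - 4 * t \<le> ln (real m)\<close> s u3 y by (intro powr_mono2) (auto simp: s_def algebra_simps)
      finally have "exp (L - 8 * (1 + y) * L * t) \<le> phi y (real m)" by (simp add: phi_def)
      moreover have "x * (1 + (- (8 * (1 + y) * L * t))) \<le> x * exp (- (8 * (1 + y) * L * t))"
        using x1 by (intro mult_left_mono exp_ge_add_one_self) auto
      moreover have "x * exp (- (8 * (1 + y) * L * t)) = exp (L - 8 * (1 + y) * L * t)"
        unfolding xL by (simp flip: exp_add)
      ultimately show ?thesis by simp
    qed
    have low: "x * t / 2 \<le> x - real (psi y m)"
      using phi_up psi_le_phi[OF m(3), of y] by (simp add: algebra_simps)
    have xt: "x * t = exp (L - u)" by (simp add: xL t_def exp_diff exp_minus field_simps)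
    have "1 \<le> x * t * L"
    proof -
      have "1 * 1 \<le> x * t * L" unfolding xt using uleL u3 by (intro mult_mono) auto
      thus ?thesis by simp
    qed
    hence up: "x - real (psi y m) \<le> K * (x * t) * L"
      using phi_low psi_ge_phi[OF m(3), of y] by (simp add: K_def algebra_simps)
    have pos: "0 < x * t / 2" using x1 t by simp
    show "\<exists>m. real (psi y m) < x \<and>
       ln x - 2 * sqrt (ln x) \<le> ln (x - real (psi y m)) \<and>
       ln (x - real (psi y m)) \<le> ln x - ln x powr (1 / (1 + y)) + ln (ln x) + ln K"
    proof (intro exI[of _ m] conjI)
      show "real (psi y m) < x" using low pos by linarith
      have "ln (2::real) \<le> 1" using ln_le_minus_one[of "2::real"] by simp
      hence "L - 2 * sqrt L \<le> ln (x * t / 2)"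
        using usq u3 by (simp add: xt ln_div)
      also have "\<dots> \<le> ln (x - real (psi y m))" using low pos by (intro ln_mono) auto
      finally show "ln x - 2 * sqrt (ln x) \<le> ln (x - real (psi y m))" by (simp add: L_def)
      have K0: "K > 0" using y by (simp add: K_def)
      have "ln (x - real (psi y m)) \<le> ln (K * (x * t) * L)" using low pos up by (intro ln_mono) auto
      also have "\<dots> = ln K + (L - u) + ln L" using K0 L0 by (simp add: xt ln_mult)
      finally show "ln (x - real (psi y m)) \<le> ln x - ln x powr (1 / (1 + y)) + ln (ln x) + ln K"
        by (simp add: L_def u_def)
    qed
  qed
qed

text \<open>With \<open>s = 2 / sqrt L\<close> one has \<open>l \<ge> L * (1 - s)\<close>, and
  \<open>(1 - s) powr b \<ge> 1 - s\<close>. The loss \<open>L powr b * s\<close> is at most 2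
  because \<open>b \<le> 1/2\<close> gives \<open>L powr b \<le> sqrt L\<close>.\<close>

lemma powr_loss_le:
  fixes L l b :: real
  assumes "L > 4" "L - 2 * sqrt L \<le> l" "0 \<le> b" "b \<le> 1/2"
  shows "L powr b - 2 \<le> l powr b"
proof -
  have sq: "sqrt L > 2" using assms(1) by (simp add: real_less_rsqrt)
  have sq2: "sqrt L * sqrt L = L" using assms(1) by simp
  define s where "s = 2 / sqrt L"
  have s: "0 < s" "s < 1" "L * s = 2 * sqrt L"
  proof -
    have "sqrt L * s = 2" using sq assms(1) by (simp add: s_def)
    thus "L * s = 2 * sqrt L" by (metis sq2 mult.assoc mult.commute)
    show "0 < s" "s < 1" using sq assms(1) by (simp_all add: s_def)
  qed
  have sqle: "2 * sqrt L \<le> L" using mult_right_mono[of 2 "sqrt L" "sqrt L"] sq sq2 by simp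
  have "L powr b \<le> L powr (1/2)" using assms by (intro powr_mono) auto
  hence Lb: "L powr b \<le> sqrt L" using assms by (simp add: powr_half_sqrt)
  have "L powr b - 2 \<le> L powr b - L powr b * s"
    using mult_right_mono[OF Lb, of s] s sq by (simp add: s_def)
  also have "\<dots> = L powr b * (1 - s) powr 1" using s by (simp add: algebra_simps)
  also have "\<dots> \<le> L powr b * (1 - s) powr b" using s assms by (intro mult_left_mono powr_mono') auto
  also have "\<dots> = (L * (1 - s)) powr b" using s assms by (simp add: powr_mult)
  also have "\<dots> \<le> l powr b" using assms s sqle by (intro powr_mono2) (auto simp: algebra_simps)
  finally show ?thesis .
qed

lemma weight_loss_le:
  assumes "L > 4" "L - 2 * sqrt L \<le> l" "\<forall>y\<in>set ys. y \<ge> 1"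
  shows "weight ys L - 2 * real (length ys) \<le> weight ys l"
  using assms(3)
proof (induction ys)
  case (Cons y ys)
  have "L powr (1 / (1 + y)) - 2 \<le> l powr (1 / (1 + y))"
    using assms Cons.prems by (intro powr_loss_le) (auto simp: field_simps)
  with Cons show ?case by simp
qed auto

text \<open>The greedy expansion: subtract a value of \<open>psi y\<close> just below
  \<open>x\<close> and expand the remainder in the other series. Each step gains its own term of the
  weight, up to a multiple of \<open>ln (ln x)\<close>.\<close>

lemma rep_below:
  assumes "\<forall>y\<in>set ys. y \<ge> 1"
  obtains c x0 :: real where "c \<ge> 0"
    "\<And>x. x \<ge> x0 \<Longrightarrow> \<exists>n. rep ys n > 0 \<and> real n \<le> x \<and>
        x - real n \<le> exp (ln x - weight ys (ln x) + c * ln (ln x))"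
proof -
  have "\<exists>c\<ge>0. \<exists>x0. \<forall>x\<ge>x0. \<exists>n. rep ys n > 0 \<and> real n \<le> x \<and>
        x - real n \<le> exp (ln x - weight ys (ln x) + c * ln (ln x))"
    using assms
  proof (induction ys)
    case Nil
    show ?case by (intro exI[of _ 0] exI[of _ 1] conjI allI impI) auto
  next
    case (Cons y ys)
    then obtain c x0 where c: "c \<ge> 0" and IH: "\<And>x. x \<ge> x0 \<Longrightarrow> \<exists>n. rep ys n > 0 \<and> real n \<le> x \<and>
        x - real n \<le> exp (ln x - weight ys (ln x) + c * ln (ln x))" by auto
    from Cons.prems have y: "y \<ge> 1" by simp
    obtain C x1 where C: "C \<ge> 0" and step: "\<And>x. x \<ge> x1 \<Longrightarrow> \<exists>m. real (psi y m) < x \<and>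
       ln x - 2 * sqrt (ln x) \<le> ln (x - real (psi y m)) \<and>
       ln (x - real (psi y m)) \<le> ln x - ln x powr (1 / (1 + y)) + ln (ln x) + C"
      using psi_below[OF y] by metis
    define k where "k = real (length ys)"
    have "filterlim (\<lambda>x. ln x - 2 * sqrt (ln x)) at_top (at_top :: real filter)" by real_asymp
    hence "\<forall>\<^sub>F x in at_top. ln x - 2 * sqrt (ln x) \<ge> ln (max x0 2)" by (simp add: filterlim_at_top)
    moreover have "\<forall>\<^sub>F x in at_top. ln (ln x) \<ge> (1::real)" by real_asymp
    moreover have "\<forall>\<^sub>F x in at_top. ln x > (4::real)" by real_asymp
    ultimately have "\<forall>\<^sub>F x in at_top. ln x - 2 * sqrt (ln x) \<ge> ln (max x0 2) \<and> ln (ln x) \<ge> 1 \<and>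
        ln x > 4 \<and> x \<ge> max 1 x1"
      using eventually_ge_at_top[of "max 1 x1"] by eventually_elim auto
    then obtain X where X: "\<And>x. x \<ge> X \<Longrightarrow> ln x - 2 * sqrt (ln x) \<ge> ln (max x0 2) \<and> ln (ln x) \<ge> 1 \<and>
        ln x > 4 \<and> x \<ge> max 1 x1"
      unfolding eventually_at_top_linorder by blast
    \<comment> \<open>The new constant adds 1 for the \<open>ln (ln x)\<close> lost in this step,
      \<open>2 * k\<close> for evaluating the remaining weight at the remainder, and
      \<open>C\<close> from \<open>psi_below\<close>; bounded losses are charged to
      \<open>ln (ln x) \<ge> 1\<close>.\<close>
    show ?case
    proof (rule exI[of _ "c + 1 + 2 * k + C"], rule conjI, goal_cases)
      case 1
      show ?case using c C by (simp add: k_def)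
    next
      case 2
      show ?case
      proof (rule exI[of _ X], intro allI impI)
        fix x assume "x \<ge> X"
        from X[OF this] have x: "ln x - 2 * sqrt (ln x) \<ge> ln (max x0 2)" "ln (ln x) \<ge> 1" "ln x > 4"
          "x \<ge> x1" "x \<ge> 1" by auto
        obtain m where m: "real (psi y m) < x"
          "ln x - 2 * sqrt (ln x) \<le> ln (x - real (psi y m))"
          "ln (x - real (psi y m)) \<le> ln x - ln x powr (1 / (1 + y)) + ln (ln x) + C"
          using step[OF x(4)] by blast
        define r where "r = x - real (psi y m)"
        have r0: "r > 0" using m(1) by (simp add: r_def)
        have "ln (max x0 2) \<le> ln r" using x(1) m(2) by (simp add: r_def)
        hence rx: "max x0 2 \<le> r" using r0 by (subst (asm) ln_le_cancel_iff) auto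
        hence lnr0: "ln r > 0" by simp
        have lnrx: "ln r \<le> ln x" using r0 by (intro ln_mono) (auto simp: r_def)
        have lnlnrx: "ln (ln r) \<le> ln (ln x)" using lnr0 lnrx by (rule ln_mono[rotated])
        obtain n where n: "rep ys n > 0" "real n \<le> r"
          "r - real n \<le> exp (ln r - weight ys (ln r) + c * ln (ln r))"
          using IH[of r] rx by auto
        show "\<exists>n. rep (y # ys) n > 0 \<and> real n \<le> x \<and>
            x - real n \<le> exp (ln x - weight (y # ys) (ln x) + (c + 1 + 2 * k + C) * ln (ln x))"
        proof (intro exI[of _ "psi y m + n"] conjI)
          show "rep (y # ys) (psi y m + n) > 0" using y n(1) by (intro rep_Cons_pos) auto
          show "real (psi y m + n) \<le> x" using n(2) by (simp add: r_def)
          have "x - real (psi y m + n) = r - real n" by (simp add: r_def)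
          also note n(3)
          also have "exp (ln r - weight ys (ln r) + c * ln (ln r)) \<le>
              exp (ln x - weight (y # ys) (ln x) + (c + 1 + 2 * k + C) * ln (ln x))"
          proof -
            have "weight ys (ln x) - 2 * k \<le> weight ys (ln r)"
              unfolding k_def using x m Cons.prems by (intro weight_loss_le) (auto simp: r_def)
            moreover have "c * ln (ln r) \<le> c * ln (ln x)" using c lnlnrx by (intro mult_left_mono)
            moreover have "2 * k + C \<le> (2 * k + C) * ln (ln x)"
              using x(2) C by (simp add: k_def mult_le_cancel_left1)
            moreover have "ln r \<le> ln x - ln x powr (1 / (1 + y)) + ln (ln x) + C" using m(3) by (simp add: r_def)
            ultimately show ?thesis by (simp add: algebra_simps)
          qed
          finally show "x - real (psi y m + n) \<le>
              exp (ln x - weight (y # ys) (ln x) + (c + 1 + 2 * k + C) * ln (ln x))" .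
        qed
      qed
    qed
  qed
  thus ?thesis using that by blast
qed

section \<open>Comparison of densities\<close>

text \<open>The exponents of a dominating product outnumber the others by more than any power of \<open>ln N\<close>.\<close>

definition dominates :: "real list \<Rightarrow> real list \<Rightarrow> bool" where
  "dominates ys zs \<longleftrightarrow> filterlim (\<lambda>L. (weight ys L - weight zs L) / ln L) at_top at_top"

lemma dominates_trans:
  assumes "dominates xs ys" "dominates ys zs"
  shows "dominates xs zs"
  using filterlim_at_top_add_at_top[OF assms[unfolded dominates_def]]
  by (simp add: dominates_def diff_divide_distrib)

lemma dominates_imp_exp_tendsto_0:
  assumes "dominates ys zs"
  shows "((\<lambda>L. exp (weight zs L - weight ys L + C * ln L)) \<longlongrightarrow> 0) at_top"
proof -
  have "filterlim (\<lambda>L. - C + (weight ys L - weight zs L) / ln L) at_top at_top"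
    using assms unfolding dominates_def by (intro filterlim_tendsto_add_at_top[OF tendsto_const])
  hence "filterlim (\<lambda>L. ln L * (- C + (weight ys L - weight zs L) / ln L)) at_top at_top"
    using ln_at_top by (rule filterlim_at_top_mult_at_top[rotated])
  hence "filterlim (\<lambda>L. - (ln L * (- C + (weight ys L - weight zs L) / ln L))) at_bot at_top"
    by (simp add: filterlim_uminus_at_top)
  hence "((\<lambda>L. exp (- (ln L * (- C + (weight ys L - weight zs L) / ln L)))) \<longlongrightarrow> 0) at_top"
    by (rule filterlim_compose[OF exp_at_bot])
  moreover have "\<forall>\<^sub>F L in at_top. exp (- (ln L * (- C + (weight ys L - weight zs L) / ln L))) =
      exp (weight zs L - weight ys L + C * ln L)"
    using eventually_gt_at_top[of "1::real"] by eventually_elim (simp add: field_simps)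
  ultimately show ?thesis by (rule Lim_transform_eventually)
qed

text \<open>Factoring out the largest power leaves a sum tending to \<open>d i0 > 0\<close>, and a
  positive power of \<open>L\<close> outgrows \<open>ln L\<close>.\<close>

lemma powr_sum_over_ln_at_top:
  fixes b d :: "'a \<Rightarrow> real"
  assumes "finite I" "i0 \<in> I" "d i0 > 0" "b i0 > 0" "\<And>i. i \<in> I - {i0} \<Longrightarrow> b i < b i0"
  shows "filterlim (\<lambda>L. (\<Sum>i\<in>I. d i * L powr b i) / ln L) at_top at_top"
proof -
  have "((\<lambda>L. \<Sum>i\<in>I. d i * L powr (b i - b i0)) \<longlongrightarrow> (\<Sum>i\<in>I. if i = i0 then d i0 else 0)) at_top"
  proof (intro tendsto_sum)
    fix i assume i: "i \<in> I"
    show "((\<lambda>L. d i * L powr (b i - b i0)) \<longlongrightarrow> (if i = i0 then d i0 else 0)) at_top"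
    proof (cases "i = i0")
      case True
      have "\<forall>\<^sub>F L in at_top. d i0 = d i * L powr (b i - b i0)"
        using eventually_gt_at_top[of "0::real"] by eventually_elim (simp add: True)
      thus ?thesis using True by (auto intro: Lim_transform_eventually[OF tendsto_const])
    next
      case False
      hence "((\<lambda>L. L powr (b i - b i0)) \<longlongrightarrow> 0) at_top"
        using assms(5)[of i] i by (intro tendsto_neg_powr filterlim_ident) auto
      thus ?thesis using False by (auto intro: tendsto_mult_right_zero)
    qed
  qed
  also have "(\<Sum>i\<in>I. if i = i0 then d i0 else 0) = d i0" using assms(1,2) by simp
  finally have "((\<lambda>L. \<Sum>i\<in>I. d i * L powr (b i - b i0)) \<longlongrightarrow> d i0) at_top" .
  moreover have "filterlim (\<lambda>L. L powr b i0 / ln L) at_top at_top"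
    using assms(4) by real_asymp
  ultimately have "filterlim (\<lambda>L. (\<Sum>i\<in>I. d i * L powr (b i - b i0)) * (L powr b i0 / ln L)) at_top at_top"
    using assms(3) by (intro filterlim_tendsto_pos_mult_at_top)
  moreover have "\<forall>\<^sub>F L in at_top. (\<Sum>i\<in>I. d i * L powr (b i - b i0)) * (L powr b i0 / ln L) =
      (\<Sum>i\<in>I. d i * L powr b i) / ln L"
    using eventually_gt_at_top[of "0::real"]
    by eventually_elim (simp add: sum_distrib_right mult.assoc flip: powr_add)
  ultimately show ?thesis by (rule filterlim_cong[OF refl refl, THEN iffD1, rotated])
qed

lemma finite_ex_dominating:
  assumes "finite A" "A \<noteq> {}" "transp_on A R" "\<And>a b. a \<in> A \<Longrightarrow> b \<in> A \<Longrightarrow> a \<noteq> b \<Longrightarrow> R a b \<or> R b a"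
  shows "\<exists>k\<in>A. \<forall>a\<in>A - {k}. R k a"
  using assms
proof (induction A rule: finite_ne_induct)
  case (insert x A)
  have "transp_on A R" using insert.prems(1) by (rule transp_on_subset) auto
  then obtain k where k: "k \<in> A" "\<forall>a\<in>A - {k}. R k a" using insert by auto
  have "k \<noteq> x" using insert.hyps k by auto
  show ?case
  proof (cases "R k x")
    case True
    thus ?thesis using k by auto
  next
    case False
    hence xk: "R x k" using insert.prems(2)[of x k] k \<open>k \<noteq> x\<close> by auto
    have "R x a" if "a \<in> A" for a
      using transp_onD[OF insert.prems(1), of x k a] xk k that by (cases "a = k") auto
    thus ?thesis by auto
  qed
qed auto

section \<open>Elementary bounds for weights\<close>

lemma weight_le:
  assumes "\<forall>y\<in>set ys. y \<ge> 1" "L \<ge> 1"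
  shows "weight ys L \<le> real (length ys) * L powr (1/2)"
  using assms(1)
proof (induction ys)
  case (Cons y ys)
  have "L powr (1 / (1 + y)) \<le> L powr (1/2)"
    using assms(2) Cons.prems by (intro powr_mono) (auto simp: field_simps)
  with Cons show ?case by (simp add: algebra_simps)
qed auto

lemma weight_mono:
  assumes "\<forall>y\<in>set ys. y \<ge> 0" "0 \<le> L" "L \<le> L'"
  shows "weight ys L \<le> weight ys L'"
  using assms(1)
proof (induction ys)
  case (Cons y ys)
  have "L powr (1 / (1 + y)) \<le> L' powr (1 / (1 + y))"
    using assms Cons.prems by (intro powr_mono2) auto
  with Cons show ?case by simp
qed auto

text \<open>This allows counting up to \<open>2 * N\<close> at the cost of a constant factor. The
  exponents are at most 1, so \<open>(1 + 2 / L) powr b \<le> 1 + 2 / L\<close>.\<close>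

lemma weight_add_2_le:
  assumes "\<forall>y\<in>set ys. y \<ge> 0" "1 \<le> L"
  shows "weight ys (L + 2) \<le> weight ys L + 2 * real (length ys)"
  using assms(1)
proof (induction ys)
  case (Cons y ys)
  define b where "b = 1 / (1 + y)"
  have b: "0 \<le> b" "b \<le> 1" using Cons.prems by (auto simp: b_def)
  have "L + 2 = L * (1 + 2 / L)" using assms(2) by (simp add: field_simps)
  hence "(L + 2) powr b = L powr b * (1 + 2 / L) powr b"
    using assms(2) by (simp add: powr_mult)
  also have "\<dots> \<le> L powr b * (1 + 2 / L) powr 1"
    using assms(2) b by (intro mult_left_mono powr_mono) auto
  also have "\<dots> = L powr b + 2 * (L powr b / L)" using assms(2) by (simp add: distrib_left)
  also have "L powr b / L \<le> 1"
    using powr_mono[of b 1 L] assms(2) b by simp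
  finally have "(L + 2) powr b \<le> L powr b + 2" by simp
  with Cons show ?case by (simp add: b_def)
qed auto

section \<open>Nonvanishing of polynomials\<close>

text \<open>The core contradiction, with integer coefficients and the sign normalised at the
  dominant product. Domination over the empty product makes the greedy gaps of \<open>Y k0\<close>
  negligible against \<open>N\<close>.\<close>

lemma rep_combination_nonzero:
  fixes Y :: "'k \<Rightarrow> real list" and a :: "'k \<Rightarrow> int"
  assumes \<beta>: "Pisot_number \<beta> \<or> Salem_number \<beta>"
    and K: "finite K" "k0 \<in> K" and Y1: "\<And>k. k \<in> K \<Longrightarrow> \<forall>y\<in>set (Y k). y \<ge> 1"
    and dom: "\<And>k. k \<in> K - {k0} \<Longrightarrow> dominates (Y k0) (Y k)" "dominates (Y k0) []"
    and a: "a k0 > 0"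
  shows "(\<Sum>k\<in>K. of_int (a k) * (\<Prod>y\<leftarrow>Y k. xi y (inverse \<beta>))) \<noteq> 0"
proof
  assume eq0: "(\<Sum>k\<in>K. of_int (a k) * (\<Prod>y\<leftarrow>Y k. xi y (inverse \<beta>))) = 0"
  have \<beta>1: "\<beta> > 1" using \<beta> by (auto simp: Pisot_number_def Salem_number_def)
  hence x: "0 < inverse \<beta>" "inverse \<beta> < 1" by (auto simp: field_simps)
  have Y0: "\<forall>y\<in>set (Y k). y \<ge> 0" if "k \<in> K" for k using Y1[OF that] by force
  obtain D where lower: "\<And>(c :: nat \<Rightarrow> int) R. (\<Sum>i\<le>R. of_int (c i) * \<beta> ^ i) \<noteq> 0 \<Longrightarrow>
     1 \<le> \<bar>\<Sum>i\<le>R. of_int (c i) * \<beta> ^ i\<bar> * (1 + (\<Sum>i\<le>R. of_int \<bar>c i\<bar>)) ^ D"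
    using Pisot_Salem_lower_bound[OF \<beta>] by blast
  define c :: "nat \<Rightarrow> int" where "c n = (\<Sum>k\<in>K. a k * int (rep (Y k) n))" for n
  have "(\<lambda>n. \<Sum>k\<in>K. of_int (a k) * (real (rep (Y k) n) * inverse \<beta> ^ n)) sums
      (\<Sum>k\<in>K. of_int (a k) * (\<Prod>y\<leftarrow>Y k. xi y (inverse \<beta>)))"
    using x Y0 by (intro sums_sum sums_mult rep_sums) auto
  hence zero: "(\<lambda>n. of_int (c n) * inverse \<beta> ^ n) sums 0"
    by (simp add: eq0 c_def sum_distrib_right mult.assoc)

  define l where "l k = real (length (Y k))" for k
  have cum: "(\<Sum>n\<le>N. real (rep (Y k) n)) \<le> 2 powr l k * exp (weight (Y k) (ln (real N + 1)))"
    if "k \<in> K" for k N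
    using sum_rep_le_exp[OF Y0[OF that], of N] by (simp add: l_def powr_realpow)
  \<comment> \<open>All weights are of order at most the square root of \<open>ln N\<close>, so the
    counting functions grow more slowly than any positive power of \<open>N\<close>.\<close>
  have growth: "\<forall>\<^sub>F N in sequentially. 1 + (\<Sum>i\<le>N. real_of_int \<bar>c i\<bar>) \<le> real N powr (1/4)"
  proof -
    have "((\<lambda>N. real N powr (-1/4) + (\<Sum>k\<in>K. \<bar>of_int (a k)\<bar> * (2 powr l k *
        exp (l k * ln (real N + 1) powr (1/2)) * real N powr (-1/4)))) \<longlongrightarrow> 0 + (\<Sum>k\<in>K. \<bar>of_int (a k)\<bar> * 0)) sequentially"
    proof (intro tendsto_add tendsto_sum tendsto_mult tendsto_const)
      show "((\<lambda>N. real N powr (-1/4)) \<longlongrightarrow> 0) sequentially" by real_asymp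
      fix k
      have "l k \<ge> 0" by (simp add: l_def)
      thus "((\<lambda>N. 2 powr l k * exp (l k * ln (real N + 1) powr (1/2)) * real N powr (-1/4)) \<longlongrightarrow> 0) sequentially"
        by (cases "l k = 0") real_asymp+
    qed
    hence "\<forall>\<^sub>F N in sequentially. real N powr (-1/4) + (\<Sum>k\<in>K. \<bar>of_int (a k)\<bar> * (2 powr l k *
        exp (l k * ln (real N + 1) powr (1/2)) * real N powr (-1/4))) < 1"
      by (rule order_tendstoD) simp
    moreover have "\<forall>\<^sub>F N in sequentially. ln (real N + 1) \<ge> 1" by real_asymp
    ultimately show ?thesis using eventually_gt_at_top[of 0]
    proof eventually_elim
      case (elim N)
      have "(\<Sum>i\<le>N. real_of_int \<bar>c i\<bar>) \<le> (\<Sum>i\<le>N. \<Sum>k\<in>K. \<bar>of_int (a k)\<bar> * real (rep (Y k) i))"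
      proof (intro sum_mono)
        fix i
        have "\<bar>c i\<bar> \<le> (\<Sum>k\<in>K. \<bar>a k * int (rep (Y k) i)\<bar>)" unfolding c_def by (rule sum_abs)
        hence "real_of_int \<bar>c i\<bar> \<le> of_int (\<Sum>k\<in>K. \<bar>a k * int (rep (Y k) i)\<bar>)" by (rule of_int_le_iff[THEN iffD2])
        thus "real_of_int \<bar>c i\<bar> \<le> (\<Sum>k\<in>K. \<bar>of_int (a k)\<bar> * real (rep (Y k) i))"
          by (simp add: abs_mult)
      qed
      also have "\<dots> = (\<Sum>k\<in>K. \<bar>of_int (a k)\<bar> * (\<Sum>i\<le>N. real (rep (Y k) i)))"
        by (subst sum.swap) (simp add: sum_distrib_left)
      also have "\<dots> \<le> (\<Sum>k\<in>K. \<bar>of_int (a k)\<bar> * (2 powr l k * exp (l k * ln (real N + 1) powr (1/2))))"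
      proof (intro sum_mono mult_left_mono)
        fix k assume k: "k \<in> K"
        have "weight (Y k) (ln (real N + 1)) \<le> l k * ln (real N + 1) powr (1/2)"
          unfolding l_def using Y1[OF k] elim(2) by (rule weight_le)
        hence "2 powr l k * exp (weight (Y k) (ln (real N + 1))) \<le> 2 powr l k * exp (l k * ln (real N + 1) powr (1/2))"
          by (intro mult_left_mono) auto
        thus "(\<Sum>i\<le>N. real (rep (Y k) i)) \<le> 2 powr l k * exp (l k * ln (real N + 1) powr (1/2))"
          using cum[OF k, of N] by linarith
      qed auto
      finally have "1 + (\<Sum>i\<le>N. real_of_int \<bar>c i\<bar>) \<le>
        1 + (\<Sum>k\<in>K. \<bar>of_int (a k)\<bar> * (2 powr l k * exp (l k * ln (real N + 1) powr (1/2))))" by simp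
      also have "\<dots> = (real N powr (-1/4) + (\<Sum>k\<in>K. \<bar>of_int (a k)\<bar> * (2 powr l k *
        exp (l k * ln (real N + 1) powr (1/2)) * real N powr (-1/4)))) * real N powr (1/4)"
        using elim(3) by (simp add: distrib_right sum_distrib_right mult.assoc flip: powr_add)
      also have "\<dots> \<le> 1 * real N powr (1/4)" using elim(1) by (intro mult_right_mono) auto
      finally show ?case by simp
    qed
  qed
  have no_iso: "\<forall>\<^sub>F N in sequentially. \<forall>m H. real N powr (1/2) \<le> real H \<and> H \<le> m \<and> m + H \<le> N \<and>
    (\<forall>n\<in>{m - H<..<m + H}. c n \<ge> 0) \<longrightarrow> c m \<le> 0"
    by (rule no_isolated_positive_coefficient[OF \<beta>1 lower zero growth])
  \<comment> \<open>The search for an isolated exponent takes place in (N, 2N], so the previous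
    statement is used at \<open>2 * N\<close>.\<close>
  have "filterlim (\<lambda>N::nat. 2 * N) sequentially sequentially"
    by (rule filterlim_subseq) (auto simp: strict_mono_def)
  with no_iso have e1: "\<forall>\<^sub>F N in sequentially. \<forall>m H. real (2 * N) powr (1/2) \<le> real H \<and> H \<le> m \<and> m + H \<le> 2 * N \<and>
    (\<forall>n\<in>{m - H<..<m + H}. c n \<ge> 0) \<longrightarrow> c m \<le> 0"
    by (rule eventually_compose_filterlim)

  obtain g x0 where g: "g \<ge> 0" and below: "\<And>x. x \<ge> x0 \<Longrightarrow> \<exists>n. rep (Y k0) n > 0 \<and> real n \<le> x \<and>
        x - real n \<le> exp (ln x - weight (Y k0) (ln x) + g * ln (ln x))"
    using rep_below[OF Y1[OF K(2)]] by metis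
  define W where "W = weight (Y k0)"
  \<comment> \<open>\<open>M (ln N)\<close> bounds the number of exponents of the other products up
    to \<open>2 * N\<close>. \<open>N * G (ln N)\<close> bounds the greedy gap below any
    \<open>x\<close> between \<open>N\<close> and \<open>2 * N\<close>: the 1 covers
    \<open>ln x \<le> ln N + 1\<close> and the 2 covers
    \<open>ln (ln x) \<le> 2 * ln (ln N)\<close>.\<close>
  define M where "M L = (\<Sum>k\<in>K-{k0}. 2 powr l k * exp (weight (Y k) L + 2 * l k))" for L
  define G where "G L = exp (1 - W L + 2 * g * ln L)" for L
  \<comment> \<open>The 6 is 3, for blocks made of three parts of length \<open>H\<close>, times 2,
    for rounding the gap bound \<open>h\<close> up to \<open>H \<le> 2 * h\<close>.\<close>
  have "((\<lambda>L. 6 * (G L * (M L + 1))) \<longlongrightarrow> 0) at_top"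
  proof -
    have "((\<lambda>L. 6 * (exp 1 * ((\<Sum>k\<in>K-{k0}. 2 powr l k * exp (2 * l k) *
        exp (weight (Y k) L - weight (Y k0) L + (2 * g) * ln L)) +
        exp (weight [] L - weight (Y k0) L + (2 * g) * ln L)))) \<longlongrightarrow>
        6 * (exp 1 * ((\<Sum>k\<in>K-{k0}. 2 powr l k * exp (2 * l k) * 0) + 0))) at_top"
      using dom by (intro tendsto_intros dominates_imp_exp_tendsto_0)
    moreover have "exp 1 * (\<Sum>k\<in>K-{k0}. 2 powr l k * exp (2 * l k) *
        exp (weight (Y k) L - weight (Y k0) L + (2 * g) * ln L)) = G L * M L" for L
      unfolding M_def sum_distrib_left
    proof (intro sum.cong refl)
      fix k
      have "exp 1 * exp (2 * l k) * exp (weight (Y k) L - weight (Y k0) L + (2 * g) * ln L) =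
          G L * exp (weight (Y k) L + 2 * l k)"
        unfolding G_def W_def exp_add[symmetric] by (rule arg_cong[of _ _ exp]) simp
      thus "exp 1 * (2 powr l k * exp (2 * l k) * exp (weight (Y k) L - weight (Y k0) L + (2 * g) * ln L)) =
          G L * (2 powr l k * exp (weight (Y k) L + 2 * l k))" by (simp add: mult_ac)
    qed
    moreover have "exp 1 * exp (weight [] L - weight (Y k0) L + (2 * g) * ln L) = G L" for L
      unfolding G_def W_def exp_add[symmetric] by (rule arg_cong[of _ _ exp]) simp
    ultimately have "((\<lambda>L. 6 * (G L * M L + G L)) \<longlongrightarrow> 0) at_top"
      by (simp add: distrib_left del: weight_Nil)
    thus ?thesis by (simp add: distrib_left)
  qed
  hence "((\<lambda>N. 6 * (G (ln (real N)) * (M (ln (real N)) + 1))) \<longlongrightarrow> 0) sequentially"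
    by (rule filterlim_compose) real_asymp
  hence e2: "\<forall>\<^sub>F N in sequentially. 6 * (G (ln (real N)) * (M (ln (real N)) + 1)) < 1"
    by (rule order_tendstoD) simp
  have "l k0 \<ge> 0" by (simp add: l_def)
  have e3: "\<forall>\<^sub>F N in sequentially. real (2 * N) powr (1/2) \<le> exp (ln (real N) + 1 - l k0 * ln (real N) powr (1/2))"
    using \<open>l k0 \<ge> 0\<close> by (cases "l k0 = 0") (simp, real_asymp)+
  have e4: "\<forall>\<^sub>F N in sequentially. ln (real N) \<ge> 4" by real_asymp
  have e5: "\<forall>\<^sub>F N in sequentially. ln (ln (real N) + 1) \<le> 2 * ln (ln (real N))" by real_asymp
  have e6: "\<forall>\<^sub>F N in sequentially. ln (2 * real N + 1) \<le> ln (real N) + 2" by real_asymp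
  have e7: "\<forall>\<^sub>F N in sequentially. real N \<ge> max 1 x0"
    using filterlim_real_sequentially unfolding filterlim_at_top by blast
  have "\<forall>\<^sub>F N :: nat in sequentially. False"
    using e1 e2 e3 e4 e5 e6 e7
  proof eventually_elim
    case (elim N)
    define L where "L = ln (real N)"
    have L4: "L \<ge> 4" using elim(4) by (simp add: L_def)
    have N1: "real N \<ge> 1" "real N \<ge> x0" using elim(7) by auto
    have NL: "exp L = real N" using N1 by (simp add: L_def)
    define h where "h = exp L * G L"
    have WL: "W L \<le> l k0 * L powr (1/2)" unfolding W_def l_def using Y1[OF K(2)] L4 by (intro weight_le) auto
    have *: "real (2 * N) powr (1/2) \<le> exp (L + 1 - l k0 * L powr (1/2))" using elim(3) by (simp add: L_def)
    have "0 \<le> 2 * g * ln L" using g L4 by simp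
    hence "exp (L + 1 - l k0 * L powr (1/2)) \<le> h"
      unfolding h_def G_def using WL by (simp flip: exp_add)
    with * have h1: "real (2 * N) powr (1/2) \<le> h" by linarith
    have "1 powr (1/2) \<le> real (2 * N) powr (1/2)" using N1 by (intro powr_mono2) auto
    hence hge1: "1 \<le> h" using h1 by simp
    define H where "H = nat \<lceil>h\<rceil>"
    have H: "h \<le> real H" "real H \<le> 2 * h" unfolding H_def using hge1 by linarith+
    define Z where "Z = {q. q \<le> 2 * N \<and> (\<exists>k\<in>K-{k0}. rep (Y k) q > 0)}"
    have finZ: "finite Z" by (auto simp: Z_def)
    have M0: "M L \<ge> 0" unfolding M_def by (intro sum_nonneg) auto
    have cardZ: "real (card Z) \<le> M L"
    proof -
      have "real (card Z) = (\<Sum>q\<in>Z. 1)" by simp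
      also have "\<dots> \<le> (\<Sum>q\<in>Z. \<Sum>k\<in>K-{k0}. real (rep (Y k) q))"
      proof (intro sum_mono)
        fix q assume "q \<in> Z"
        then obtain k where k: "k \<in> K - {k0}" "rep (Y k) q > 0" by (auto simp: Z_def)
        have "1 \<le> real (rep (Y k) q)" using k(2) by simp
        also have "\<dots> \<le> (\<Sum>k\<in>K-{k0}. real (rep (Y k) q))"
          using k(1) K(1) by (intro member_le_sum) auto
        finally show "1 \<le> (\<Sum>k\<in>K-{k0}. real (rep (Y k) q))" .
      qed
      also have "\<dots> \<le> (\<Sum>q\<le>2*N. \<Sum>k\<in>K-{k0}. real (rep (Y k) q))"
        by (intro sum_mono2) (auto simp: Z_def intro: sum_nonneg)
      also have "\<dots> = (\<Sum>k\<in>K-{k0}. \<Sum>q\<le>2*N. real (rep (Y k) q))" by (rule sum.swap)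
      also have "\<dots> \<le> M L"
        unfolding M_def
      proof (intro sum_mono)
        fix k assume "k \<in> K - {k0}"
        hence k: "k \<in> K" by simp
        have "weight (Y k) (ln (real (2 * N) + 1)) \<le> weight (Y k) (L + 2)"
          using elim(6) N1 Y0[OF k] by (intro weight_mono) (auto simp: L_def)
        also have "\<dots> \<le> weight (Y k) L + 2 * l k"
          unfolding l_def using Y0[OF k] L4 by (intro weight_add_2_le) auto
        finally have "2 powr l k * exp (weight (Y k) (ln (real (2 * N) + 1))) \<le>
           2 powr l k * exp (weight (Y k) L + 2 * l k)" by simp
        with cum[OF k, of "2 * N"]
        show "(\<Sum>q\<le>2*N. real (rep (Y k) q)) \<le> 2 powr l k * exp (weight (Y k) L + 2 * l k)"
          by linarith
      qed
      finally show ?thesis .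
    qed
    have "real (3 * H * (card Z + 1)) = 3 * real H * (real (card Z) + 1)" by (simp add: algebra_simps)
    also have "\<dots> \<le> 3 * (2 * h) * (M L + 1)"
      using H cardZ hge1 by (intro mult_mono) auto
    also have "\<dots> = exp L * (6 * (G L * (M L + 1)))" by (simp add: h_def)
    also have "\<dots> \<le> exp L * 1" using elim(2) by (intro mult_left_mono) (auto simp: L_def)
    finally have "real (3 * H * (card Z + 1)) \<le> real N" by (simp add: NL)
    hence len: "3 * H * (card Z + 1) \<le> N" by linarith
    txt \<open>
      There is a block in \<open>(N, 2N]\<close> of length \<open>3H\<close> free of exponents of the dominated products, and its
      middle third contains an exponent of the dominating one.
    \<close>
    obtain j where j: "j \<le> card Z" "Z \<inter> {N + j * (3 * H)<..N + Suc j * (3 * H)} = {}"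
      using pigeonhole_free_block[OF finZ] by metis
    define b where "b = N + j * (3 * H)"
    have "Suc j * (3 * H) \<le> (card Z + 1) * (3 * H)" using j(1) by (intro mult_right_mono) auto
    moreover have "(card Z + 1) * (3 * H) \<le> N" using len by (simp only: mult.commute)
    moreover have "b + 3 * H = N + Suc j * (3 * H)" by (simp add: b_def)
    ultimately have bN: "b + 3 * H \<le> 2 * N" by linarith
    have bN': "N \<le> b" by (simp add: b_def)
    have free: "q \<notin> Z" if "b < q" "q \<le> b + 3 * H" for q using j(2) that by (auto simp: b_def)
    \<comment> \<open>Expanding from the right end of the middle third, with gap at most
      \<open>H\<close>, puts the exponent inside that third.\<close>
    define x where "x = real (b + 2 * H)"
    have xN: "real N \<le> x" "x \<le> 2 * real N" unfolding x_def using bN bN' by linarith+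
    obtain n where n: "rep (Y k0) n > 0" "real n \<le> x"
      "x - real n \<le> exp (ln x - weight (Y k0) (ln x) + g * ln (ln x))"
      using below[of x] xN N1 by auto
    have Lx: "L \<le> ln x" unfolding L_def using xN N1 by (intro ln_mono) auto
    have "ln x \<le> ln (2 * real N)" using xN N1 by (intro ln_mono) auto
    also have "\<dots> = ln 2 + L" using N1 by (simp add: ln_mult L_def)
    also have "ln (2::real) \<le> 1" using ln_le_minus_one[of "2::real"] by simp
    finally have Lx': "ln x \<le> L + 1" by simp
    have "ln (ln x) \<le> ln (L + 1)" using Lx Lx' L4 by (intro ln_mono) linarith+
    also have "\<dots> \<le> 2 * ln L" using elim(5) by (simp add: L_def)
    finally have lnln: "g * ln (ln x) \<le> g * (2 * ln L)" using g by (intro mult_left_mono)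
    have "W L \<le> W (ln x)" unfolding W_def using Y0[OF K(2)] Lx L4 by (intro weight_mono) auto
    hence "exp (ln x - weight (Y k0) (ln x) + g * ln (ln x)) \<le> h"
      unfolding h_def G_def using Lx' lnln by (simp add: W_def flip: exp_add)
    hence "x - real n \<le> real H" using n(3) H(1) by linarith
    hence nH: "b + H \<le> n" "n \<le> b + 2 * H" using n(2) unfolding x_def by linarith+
    have cq: "c q = a k0 * int (rep (Y k0) q)" if "b < q" "q \<le> b + 3 * H" for q
    proof -
      have "rep (Y k) q = 0" if "k \<in> K - {k0}" for k
        using free[of q] \<open>b < q\<close> \<open>q \<le> b + 3 * H\<close> bN that by (auto simp: Z_def)
      hence "(\<Sum>k\<in>K-{k0}. a k * int (rep (Y k) q)) = 0" by simp
      thus ?thesis unfolding c_def using K by (simp add: sum.remove)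
    qed
    have H1: "H \<ge> 1" using H(1) hge1 by linarith
    have "\<forall>q\<in>{n - H<..<n + H}. c q \<ge> 0"
    proof
      fix q assume "q \<in> {n - H<..<n + H}"
      hence "b < q" "q \<le> b + 3 * H" using nH by auto
      thus "c q \<ge> 0" using a by (simp add: cq)
    qed
    moreover have "real (2 * N) powr (1/2) \<le> real H" using h1 H(1) by linarith
    moreover have "H \<le> n" "n + H \<le> 2 * N" using nH bN by linarith+
    ultimately have "c n \<le> 0" using elim(1) by blast
    moreover have "c n > 0"
      using nH H1 a n(1) by (subst cq) auto
    ultimately show False by simp
  qed
  thus False by simp
qed

section \<open>Monomials as lists of parameters\<close>

text \<open>Each parameter is repeated as often as its variable occurs, so that the product over the
  list is the value of the monomial and the weight is linear in the exponent vector.\<close>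

definition monom_list :: "nat \<Rightarrow> (nat \<Rightarrow> 'a) \<Rightarrow> (nat \<Rightarrow>\<^sub>0 nat) \<Rightarrow> 'a list" where
  "monom_list n y m = concat (map (\<lambda>i. replicate (Poly_Mapping.lookup m i) (y i)) [0..<n])"

lemma monom_list_0 [simp]: "monom_list n y 0 = []"
  by (simp add: monom_list_def)

lemma set_monom_list: "set (monom_list n y m) \<subseteq> y ` {..<n}"
  by (auto simp: monom_list_def)

lemma prod_monom_list:
  fixes f :: "'a \<Rightarrow> 'b :: comm_monoid_mult"
  shows "(\<Prod>z\<leftarrow>monom_list n y m. f z) = (\<Prod>i<n. f (y i) ^ Poly_Mapping.lookup m i)"
  by (induction n) (simp_all add: monom_list_def)

lemma weight_append: "weight (ys @ zs) L = weight ys L + weight zs L"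
  by (simp add: weight_def)

lemma weight_monom_list:
  "weight (monom_list n y m) L = (\<Sum>i<n. real (Poly_Mapping.lookup m i) * L powr (1 / (1 + y i)))"
proof (induction n)
  case (Suc n)
  have "weight (replicate k (y n)) L = real k * L powr (1 / (1 + y n))" for k
    by (induction k) (simp_all add: algebra_simps)
  with Suc show ?case by (simp add: monom_list_def weight_append)
qed (simp add: monom_list_def)

text \<open>The difference of weights is a combination of powers of \<open>L\<close>, whose
  exponents are distinct because \<open>y\<close> is injective. The sign of the coefficient at the
  largest one with nonzero coefficient decides.\<close>

lemma dominates_monom_list_total:
  assumes inj: "inj_on y {..<n}" and y: "\<And>i. i < n \<Longrightarrow> y i \<ge> 1"
    and keys: "Poly_Mapping.keys m \<subseteq> {..<n}" "Poly_Mapping.keys m' \<subseteq> {..<n}" and "m \<noteq> m'"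
  shows "dominates (monom_list n y m) (monom_list n y m') \<or>
    dominates (monom_list n y m') (monom_list n y m)"
proof -
  define b where "b i = 1 / (1 + y i)" for i
  define d where "d i = real (Poly_Mapping.lookup m i) - real (Poly_Mapping.lookup m' i)" for i
  define I where "I = {i. i < n \<and> d i \<noteq> 0}"
  have finI: "finite I" by (simp add: I_def)
  have "I \<noteq> {}"
  proof
    assume "I = {}"
    hence "Poly_Mapping.lookup m i = Poly_Mapping.lookup m' i" for i
    proof (cases "i < n")
      case True
      thus ?thesis using \<open>I = {}\<close> by (auto simp: I_def d_def)
    next
      case False
      hence "i \<notin> Poly_Mapping.keys m" "i \<notin> Poly_Mapping.keys m'" using keys by auto
      thus ?thesis by (simp add: in_keys_iff)
    qed
    thus False using \<open>m \<noteq> m'\<close> by (auto intro: poly_mapping_eqI)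
  qed
  hence "Max (b ` I) \<in> b ` I" using finI by (intro Max_in) auto
  then obtain i0 where i0: "i0 \<in> I" "b i0 = Max (b ` I)" by force
  have lt: "b i < b i0" if "i \<in> I - {i0}" for i
  proof -
    have "b i \<le> b i0" unfolding i0(2) using that finI by (intro Max_ge) auto
    moreover have "y i \<noteq> y i0" using that i0(1) inj by (auto simp: I_def inj_on_def)
    hence "b i \<noteq> b i0" using y[of i] y[of i0] that i0(1) by (simp add: b_def I_def)
    ultimately show ?thesis by linarith
  qed
  have b0: "b i0 > 0" using y[of i0] i0(1) by (simp add: b_def I_def)
  have diff: "weight (monom_list n y m) L - weight (monom_list n y m') L = (\<Sum>i\<in>I. d i * L powr b i)" for L
  proof -
    have "weight (monom_list n y m) L - weight (monom_list n y m') L = (\<Sum>i<n. d i * L powr b i)"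
      by (simp add: weight_monom_list d_def b_def left_diff_distrib sum_subtractf)
    also have "\<dots> = (\<Sum>i\<in>I. d i * L powr b i)"
      by (rule sum.mono_neutral_right) (auto simp: I_def)
    finally show ?thesis .
  qed
  have diff': "weight (monom_list n y m') L - weight (monom_list n y m) L = (\<Sum>i\<in>I. (- d i) * L powr b i)" for L
    using diff[of L] by (simp add: sum_negf)
  have "d i0 > 0 \<or> - d i0 > 0" using i0(1) by (auto simp: I_def)
  thus ?thesis unfolding dominates_def diff diff'
    using powr_sum_over_ln_at_top[of I i0 d b]
      powr_sum_over_ln_at_top[of I i0 "\<lambda>i. - d i" b]
      finI i0(1) b0 lt by blast
qed

lemma not_dominates_Nil: "\<not> dominates [] zs"
proof
  assume "dominates [] zs"
  hence "\<forall>\<^sub>F L in at_top. (0 - weight zs L) / ln L \<ge> 1"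
    unfolding dominates_def filterlim_at_top weight_Nil by blast
  moreover have "\<forall>\<^sub>F L in at_top. (0 - weight zs L) / ln L \<le> 0"
    using eventually_gt_at_top[of "1::real"]
  proof eventually_elim
    case (elim L)
    have "weight zs L \<ge> 0" unfolding weight_def by (rule sum_list_nonneg) auto
    thus ?case using elim by (simp add: field_simps)
  qed
  ultimately have "\<forall>\<^sub>F L in at_top :: real filter. False"
    by eventually_elim linarith
  thus False by simp
qed

lemma common_denominator:
  fixes c :: "'a \<Rightarrow> rat"
  assumes "finite A"
  shows "\<exists>d::int. d > 0 \<and> (\<forall>a\<in>A. of_int d * c a \<in> \<int>)"
  using assms
proof (induction A rule: finite_induct)
  case (insert a A)
  then obtain d :: int where d: "d > 0" "\<forall>a\<in>A. of_int d * c a \<in> \<int>" by blast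
  obtain p q where pq: "c a = of_int p / of_int q" "q > 0" using quotient_of_div[of "c a"]
    by (metis quotient_of_denom_pos surj_pair)
  show ?case
  proof (intro exI[of _ "q * d"] conjI ballI)
    show "q * d > 0" using pq d by simp
    fix x assume "x \<in> insert a A"
    thus "of_int (q * d) * c x \<in> \<int>"
    proof
      assume "x = a"
      hence "of_int (q * d) * c x = of_int (d * p)" using pq by simp
      thus ?thesis by (metis Ints_of_int)
    next
      assume "x \<in> A"
      hence "of_int q * (of_int d * c x) \<in> \<int>" using d pq by - (rule Ints_mult[OF Ints_of_int], auto)
      thus ?thesis by (simp add: mult.assoc)
    qed
  qed
qed (auto intro: exI[of _ 1])

text \<open>Injectivity is asked of the parameters, not of the values, so that injectivity of
  \<open>xi\<close> can itself be deduced from this lemma.\<close>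

lemma mpoly_eval_xi_nonzero:
  assumes \<beta>: "Pisot_number \<beta> \<or> Salem_number \<beta>"
    and inj: "inj_on y {..<n}" and y: "\<And>i. i < n \<Longrightarrow> y i \<ge> 1"
    and x: "\<And>i. i < n \<Longrightarrow> x i = xi (y i) (inverse \<beta>)"
    and vars: "mpoly_vars P \<subseteq> {..<n}" and P: "P \<noteq> 0"
  shows "mpoly_eval x P \<noteq> 0"
proof -
  define K where "K = Poly_Mapping.keys P"
  define Y where "Y = monom_list n y"
  have K: "finite K" "K \<noteq> {}" using P by (auto simp: K_def)
  have keysK: "Poly_Mapping.keys m \<subseteq> {..<n}" if "m \<in> insert 0 K" for m
    using that vars by (auto simp: K_def mpoly_vars_def)
  have Y1: "\<forall>z\<in>set (Y m). z \<ge> 1" for m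
    using set_monom_list[of n y m] y by (auto simp: Y_def)
  have prodY: "(\<Prod>i\<in>Poly_Mapping.keys m. x i ^ Poly_Mapping.lookup m i) = (\<Prod>z\<leftarrow>Y m. xi z (inverse \<beta>))"
    if "m \<in> K" for m
  proof -
    have "(\<Prod>i\<in>Poly_Mapping.keys m. x i ^ Poly_Mapping.lookup m i) = (\<Prod>i<n. x i ^ Poly_Mapping.lookup m i)"
      using keysK[of m] that by (intro prod.mono_neutral_left) (auto simp: in_keys_iff)
    also have "\<dots> = (\<Prod>z\<leftarrow>Y m. xi z (inverse \<beta>))"
      unfolding Y_def prod_monom_list by (intro prod.cong) (auto simp: x)
    finally show ?thesis .
  qed
  \<comment> \<open>The constant monomial takes part even when absent from \<open>P\<close>: if it
    wins, \<open>P\<close> is constant, and otherwise the winner dominates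
    \<open>[]\<close>.\<close>
  have "\<exists>k\<in>insert 0 K. \<forall>m\<in>insert 0 K - {k}. dominates (Y k) (Y m)"
  proof (rule finite_ex_dominating)
    show "transp_on (insert 0 K) (\<lambda>m m'. dominates (Y m) (Y m'))"
      by (rule transp_onI) (blast intro: dominates_trans)
    show "dominates (Y m) (Y m') \<or> dominates (Y m') (Y m)"
      if "m \<in> insert 0 K" "m' \<in> insert 0 K" "m \<noteq> m'" for m m'
      unfolding Y_def using that keysK by (intro dominates_monom_list_total inj y) auto
  qed (use K in auto)
  then obtain k where k: "k \<in> insert 0 K" "\<And>m. m \<in> insert 0 K - {k} \<Longrightarrow> dominates (Y k) (Y m)"
    by blast
  show ?thesis
  proof (cases "k = 0")
    case True
    have "m = 0" if "m \<in> K" for m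
      using k(2)[of m] that True not_dominates_Nil[of "Y m"] by (auto simp: Y_def)
    hence "K = {0}" using K(2) by auto
    moreover from this have "Poly_Mapping.lookup P 0 \<noteq> 0" by (auto simp: K_def in_keys_iff)
    ultimately show ?thesis by (simp add: mpoly_eval_def K_def)
  next
    case False
    hence kK: "k \<in> K" using k(1) by simp
    have dom: "dominates (Y k) (Y m)" if "m \<in> K - {k}" for m using k(2)[of m] that by auto
    have dom0: "dominates (Y k) []" using k(2)[of 0] False by (simp add: Y_def)
    obtain d :: int where d: "d > 0" "\<forall>m\<in>K. of_int d * Poly_Mapping.lookup P m \<in> \<int>"
      using common_denominator[OF K(1)] by blast
    \<comment> \<open>The sign makes the coefficient of the dominant monomial positive; on
      \<open>K\<close> the floor in \<open>a\<close> is exact since \<open>d\<close> clears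
      denominators.\<close>
    define s :: int where "s = (if Poly_Mapping.lookup P k > 0 then 1 else -1)"
    define a where "a m = s * \<lfloor>of_int d * Poly_Mapping.lookup P m\<rfloor>" for m
    have a: "of_int (a m) = real_of_int (s * d) * of_rat (Poly_Mapping.lookup P m)" if "m \<in> K" for m
    proof -
      have "rat_of_int (a m) = of_int (s * d) * Poly_Mapping.lookup P m"
        using d(2) that by (auto simp: a_def elim!: Ints_cases)
      hence "real_of_rat (of_int (a m)) = of_rat (of_int (s * d) * Poly_Mapping.lookup P m)" by simp
      thus ?thesis by (simp add: of_rat_mult)
    qed
    have "real_of_int (a k) > 0"
    proof -
      have "Poly_Mapping.lookup P k \<noteq> 0" using kK by (simp add: K_def in_keys_iff)
      thus ?thesis unfolding a[OF kK] using d(1) by (cases "Poly_Mapping.lookup P k > 0") (auto simp: s_def intro: mult_pos_neg)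
    qed
    hence ak: "a k > 0" by simp
    have "(\<Sum>m\<in>K. of_int (a m) * (\<Prod>z\<leftarrow>Y m. xi z (inverse \<beta>))) \<noteq> 0"
      by (rule rep_combination_nonzero[where a = a and Y = Y, OF \<beta> K(1) kK Y1 dom dom0 ak])
    also have "(\<Sum>m\<in>K. of_int (a m) * (\<Prod>z\<leftarrow>Y m. xi z (inverse \<beta>))) = of_int (s * d) * mpoly_eval x P"
      by (simp add: mpoly_eval_def sum_distrib_left a prodY mult.assoc flip: K_def)
    finally show ?thesis by auto
  qed
qed

text \<open>A coincidence of values at two parameters would be a zero of the polynomial X_0 - X_1.
  Injectivity gives the set the cardinality of the continuum.\<close>

lemma inj_on_xi:
  assumes \<beta>: "Pisot_number \<beta> \<or> Salem_number \<beta>"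
  shows "inj_on (\<lambda>y. xi y (inverse \<beta>)) {1..}"
proof (rule inj_onI, rule ccontr)
  fix y z :: real
  assume yz: "y \<in> {1..}" "z \<in> {1..}" "xi y (inverse \<beta>) = xi z (inverse \<beta>)" "y \<noteq> z"
  define X :: "nat \<Rightarrow> (nat \<Rightarrow>\<^sub>0 nat)" where "X i = Poly_Mapping.single i 1" for i
  define P :: rat_mpoly where "P = Poly_Mapping.single (X 0) 1 - Poly_Mapping.single (X 1) 1"
  define w where "w i = (if i = 0 then y else z)" for i :: nat
  define x where "x i = xi (w i) (inverse \<beta>)" for i :: nat
  have "Poly_Mapping.lookup (X 0) 0 \<noteq> Poly_Mapping.lookup (X 1) 0"
    by (simp add: X_def lookup_single when_def)
  hence X01: "X 0 \<noteq> X 1" by metis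
  have lP: "Poly_Mapping.lookup P (X 0) = 1" "Poly_Mapping.lookup P (X 1) = -1"
    using X01 by (simp_all add: P_def lookup_minus lookup_single when_def)
  have keys: "Poly_Mapping.keys P \<subseteq> {X 0, X 1}"
    by (auto simp: P_def in_keys_iff lookup_minus lookup_single when_def split: if_splits)
  have "mpoly_eval x P \<noteq> 0"
  proof (rule mpoly_eval_xi_nonzero[OF \<beta>])
    show "inj_on w {..<2}" using yz(4) by (auto simp: inj_on_def w_def)
    show "w i \<ge> 1" for i using yz by (simp add: w_def)
    show "x i = xi (w i) (inverse \<beta>)" for i by (simp add: x_def)
    show "mpoly_vars P \<subseteq> {..<2}" using keys by (auto simp: mpoly_vars_def X_def)
    show "P \<noteq> 0" using lP by auto
  qed
  moreover have "mpoly_eval x P = (\<Sum>m\<in>{X 0, X 1}. of_rat (Poly_Mapping.lookup P m) *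
        (\<Prod>i\<in>Poly_Mapping.keys m. x i ^ Poly_Mapping.lookup m i))"
    unfolding mpoly_eval_def using keys by (intro sum.mono_neutral_left) (auto simp: in_keys_iff)
  moreover have "\<dots> = x 0 - x 1" using X01 lP by (simp add: X_def)
  ultimately show False using yz(3) by (simp add: x_def w_def)
qed

theorem theorem3p1:
  fixes \<beta> :: real
  assumes "Pisot_number \<beta> \<or> Salem_number \<beta>"
  shows "{xi y (inverse \<beta>) | y :: real. y \<ge> 1} \<approx> (UNIV :: real set)
       \<and> alg_indep_over_rat {xi y (inverse \<beta>) | y :: real. y \<ge> 1}"
proof
  have "{xi y (inverse \<beta>) | y :: real. y \<ge> 1} = (\<lambda>y. xi y (inverse \<beta>)) ` {1..}" by auto
  also have "\<dots> \<approx> {1::real..}" by (rule inj_on_image_eqpoll_self[OF inj_on_xi[OF assms]])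
  also have "{1::real..} \<approx> (UNIV :: real set)" by (rule eqpoll_real_subset[of 1 2]) auto
  finally show "{xi y (inverse \<beta>) | y :: real. y \<ge> 1} \<approx> (UNIV :: real set)" .
  show "alg_indep_over_rat {xi y (inverse \<beta>) | y :: real. y \<ge> 1}"
    unfolding alg_indep_over_rat_def
  proof (intro allI impI, elim conjE)
    fix n :: nat and x :: "nat \<Rightarrow> real" and P
    assume inj: "inj_on x {..<n}" and sub: "x ` {..<n} \<subseteq> {xi y (inverse \<beta>) | y :: real. y \<ge> 1}"
      and P: "mpoly_vars P \<subseteq> {..<n}" "P \<noteq> 0"
    have "\<forall>i. \<exists>y. i < n \<longrightarrow> y \<ge> 1 \<and> x i = xi y (inverse \<beta>)" using sub by (auto simp: image_subset_iff)
    then obtain y where y: "\<And>i. i < n \<Longrightarrow> y i \<ge> 1 \<and> x i = xi (y i) (inverse \<beta>)" by metis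
    have "inj_on y {..<n}"
      using inj y by (auto simp: inj_on_def)
    thus "mpoly_eval x P \<noteq> 0" using mpoly_eval_xi_nonzero[OF assms] y P by blast
  qed
qed

end
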